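(* Consider problem (P) and Algorithm 1 described in the context. Let $\{(x_1^k,\dots,x_N^k,\lambda^k)\}_{k\ge 0}$ be a sequence generated by Algorithm 1, and suppose the parameters satisfy $$\beta>\frac{6+18\sqrt3}{13}L,\qquad \gamma\in\left(\frac{12}{13\beta+\sqrt{13\beta^2-12\beta L-72L^2}},\ \frac{12}{13\beta-\sqrt{13\beta^2-12\beta L-72L^2}}\right),$$ and $H_i\succ\frac{6L^2}{\beta}I$ for $i=1,\dots,N-1$. Define $$\kappa_1:=\frac{3}{\beta^2}\left[\left(\beta-\tfrac1\gamma\right)^2+L^2\right],\quad \kappa_2:=\left(\left|\beta-\tfrac1\gamma\right|+L\right)^2,\quad \kappa_3:=\left(L+\beta\sqrt N\max_{1\le i\le N}\|A_i\|_2^2+\max_{1\le i\le N-1}\|H_i\|_2\right)^2,$$ $$\tau:=\min\left\{-\left[\tfrac{\beta+L}{2}-\tfrac1\gamma+\tfrac6\beta\left(\beta-\tfrac1\gamma\right)^2+\tfrac{3L^2}{\beta}\right],\ \min_{1\le i\le N-1}\left[-\left(\tfrac{3L^2}{\beta}-\tfrac{\sigma_{\min}(H_i)}{2}\right)\right]\right\},$$ where $\sigma_{\min}$ denotes the smallest singular value. For $\epsilon>0$ let $$K:=\left\lceil\frac{2\max\{\kappa_1,\kappa_2,\kappa_3\}}{\tau\epsilon^2}\left(\Psi_G(x_1^1,\dots,x_N^1,\lambda^1,x_N^0)-\sum_{i=1}^{N-1}r_i^*-f^*\right)\right\rceil$$ and $k^*:=\operatorname{argmin}_{2\le k\le K+1}\sum_{i=1}^N\left(\|x_i^k-x_i^{k+1}\|^2+\|x_i^{k-1}-x_i^k\|^2\right)$.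 Then $(x_1^{k^*+1},\dots,x_N^{k^*+1})$ with multiplier $\lambda^{k^*+1}$ is an $\epsilon$-stationary solution of (P).
   Context: Problem (P): minimize $f(x_1,\dots,x_N)+\sum_{i=1}^{N-1}r_i(x_i)$ subject to $\sum_{i=1}^N A_ix_i=b$ with $A_N=I$, $x_N\in\mathbb R^{n_N}$, and $x_i\in\mathcal M_i\cap X_i$ for $i=1,\dots,N-1$. Here $A_i\in\mathbb R^{m\times n_i}$, $b\in\mathbb R^m$, $n_N=m$; $f:\mathbb R^{n_1}\times\cdots\times\mathbb R^{n_N}\to\mathbb R$ is smooth (possibly nonconvex) with $L$-Lipschitz gradient, $L>0$; $\nabla_i f$ is the partial gradient in block $x_i$; $r_i:\mathbb R^{n_i}\to\mathbb R$ is convex and locally Lipschitz (possibly nonsmooth); $\mathcal M_i$ is a Riemannian submanifold embedded in $\mathbb R^{n_i}$ (with the Euclidean inner product as metric); $X_i\subset\mathbb R^{n_i}$ is closed and convex. Assume the following are finite: $r_i^*=\min_{x_i\in\mathcal M_i\cap X_i}r_i(x_i)$ and $f^*=\min\{f(x): x_i\in\mathcal M_i\cap X_i\ (i\le N-1),\ x_N\in\mathbb R^{n_N}\}$. Augmented Lagrangian: $\mathcal L_\beta(x_1,\dots,x_N,\lambda)=f(x_1,\dots,x_N)+\sum_{i=1}^{N-1}r_i(x_i)-\langle\sum_{i=1}^N A_ix_i-b,\lambda\rangle+\frac\beta2\|\sum_{i=1}^N A_ix_i-b\|^2$. Write $\|v\|_H^2=v^\top Hv$. Potential: $\Psi_G(x_1,\dots,x_N,\lambda,\bar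 x)=\mathcal L_\beta(x_1,\dots,x_N,\lambda)+\frac3\beta\left[(\beta-\frac1\gamma)^2+L^2\right]\|\bar x-x_N\|^2$. Algorithm 1: given $x_i^0\in\mathcal M_i\cap X_i$ ($i\le N-1$), $x_N^0\in\mathbb R^{n_N}$, $\lambda^0\in\mathbb R^m$, $\beta,\gamma>0$, symmetric $H_i\succ0$; for $k=0,1,\dots$: Step 1: for $i=1,\dots,N-1$ in order, $x_i^{k+1}$ is a global minimizer (assumed to exist and be computable) over $x_i\in\mathcal M_i\cap X_i$ of $\mathcal L_\beta(x_1^{k+1},\dots,x_{i-1}^{k+1},x_i,x_{i+1}^k,\dots,x_N^k,\lambda^k)+\frac12\|x_i-x_i^k\|_{H_i}^2$. Step 2: $x_N^{k+1}=x_N^k-\gamma\nabla_N\mathcal L_\beta(x_1^{k+1},\dots,x_{N-1}^{k+1},x_N^k,\lambda^k)$. Step 3: $\lambda^{k+1}=\lambda^k-\beta(\sum_{i=1}^N A_ix_i^{k+1}-b)$. Cones: for $C\subset\mathbb R^n$ and $x\in C$, the tangent cone $T_C(x)$ is the set of $w$ such that for all sequences $x_j\to x$ in $C$ and $t_j\downarrow0$ there are $w_j\to w$ with $x_j+t_jw_j\in C$ for all $j$. For a closed subset $S$ of $\mathcal M$, $x\in S$ and a chart $(U,\psi)$ of $\mathcal M$ at $x$: $\mathcal T_S(x)=[\mathbf D\psi(x)]^{-1}[T_{\psi(S\cap U)}(\psi(x))]$ and $\mathcal N_S(x)=\{u\in\mathcal T_x\mathcal M:\langle u,v\rangle\le0\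 \forall v\in\mathcal T_S(x)\}$, where $\mathcal T_x\mathcal M$ is the tangent space. $\epsilon$-stationary solution: $x^*$ (with multiplier $\lambda^*$) is $\epsilon$-stationary for (P) if $\|\nabla_Nf(x^* )-A_N^\top\lambda^*\|\le\epsilon$, $\|\sum_{i=1}^N A_ix_i^*-b\|\le\epsilon$, and for $i=1,\dots,N-1$ $$\operatorname{dist}\left(\operatorname{Proj}_{\mathcal T_{x_i^*}\mathcal M_i}\left(-\nabla_if(x^* )+A_i^\top\lambda^*-\partial r_i(x_i^* )\right),\ \mathcal N_{X_i\cap\mathcal M_i}(x_i^* )\right)\le\epsilon,$$ where $\operatorname{dist}(A,B)=\inf_{a\in A,b\in B}\|a-b\|$, $\partial r_i$ is the convex subdifferential and $\operatorname{Proj}$ is orthogonal projection. *)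

theory Defs
  imports "HOL-Analysis.Analysis"
begin

section \<open>Coordinate blocks\<close>

text \<open>
  The block dimensions \<open>n\<^sub>1, \<dots>, n\<^sub>N\<^sub>-\<^sub>1\<close> vary with the block, so the product
  \<open>R^n\<^sub>1 \<times> \<dots> \<times> R^n\<^sub>N\<^sub>-\<^sub>1\<close> is the single space \<open>real^'c\<close>, where \<open>'c\<close> enumerates all scalar
  coordinates and a map \<open>'c \<Rightarrow> nat\<close> tells to which block a coordinate belongs. The factor
  \<open>R^n\<^sub>i\<close> is the coordinate subspace spanned by the coordinates of block \<open>i\<close>. The last block
  \<open>x\<^sub>N\<close> lives in \<open>real^'m\<close> because \<open>n\<^sub>N = m\<close>; a full point is a pair in \<open>real^'c \<times> real^'m\<close>,
  whose norm is the Euclidean norm.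
\<close>

definition coord_space :: "'c set \<Rightarrow> (real^'c) set" where
  "coord_space D = {v. \<forall>c. c \<notin> D \<longrightarrow> v $ c = 0}"

definition coord_proj :: "'c set \<Rightarrow> real^'c \<Rightarrow> real^'c" where
  "coord_proj D v = (\<chi> c. if c \<in> D then v $ c else 0)"

section \<open>Calculus and convexity\<close>

definition grad :: "('a::real_inner \<Rightarrow> real) \<Rightarrow> 'a \<Rightarrow> 'a" where
  "grad f x = (THE D. GDERIV f x :> D)"

text \<open>
  \<open>Ck_on k f S\<close> is meant for open \<open>S\<close>: the iterated directional derivatives up to order \<open>k\<close>
  exist and are continuous on \<open>S\<close>.
\<close>

primrec Ck_on :: "nat \<Rightarrow> ('a::real_normed_vector \<Rightarrow> 'b::real_normed_vector) \<Rightarrow> 'a set \<Rightarrow> bool"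
where
  "Ck_on 0 f S \<longleftrightarrow> continuous_on S f"
| "Ck_on (Suc k) f S \<longleftrightarrow>
     (\<forall>x\<in>S. f differentiable (at x)) \<and> (\<forall>v. Ck_on k (\<lambda>x. frechet_derivative f (at x) v) S)"

definition smooth_on :: "('a::real_normed_vector \<Rightarrow> 'b::real_normed_vector) \<Rightarrow> 'a set \<Rightarrow> bool"
where
  "smooth_on f S \<longleftrightarrow> (\<forall>k. Ck_on k f S)"

definition locally_lipschitz_on :: "'a::metric_space set \<Rightarrow> ('a \<Rightarrow> 'b::metric_space) \<Rightarrow> bool" where
  "locally_lipschitz_on E f \<longleftrightarrow> (\<forall>x\<in>E. \<exists>u>0. \<exists>C. C-lipschitz_on (cball x u \<inter> E) f)"

definition subdiff :: "'a::real_inner set \<Rightarrow> ('a \<Rightarrow> real) \<Rightarrow> 'a \<Rightarrow> 'a set" where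
  "subdiff E r x = {g \<in> E. \<forall>y\<in>E. r y \<ge> r x + g \<bullet> (y - x)}"

definition orth_proj :: "'a::real_inner set \<Rightarrow> 'a \<Rightarrow> 'a" where
  "orth_proj W v = (THE p. p \<in> W \<and> (\<forall>w\<in>W. (v - p) \<bullet> w = 0))"

section \<open>Embedded submanifolds, tangent spaces and cones\<close>

text \<open>
  A slice chart of \<open>M\<close> is a smooth diffeomorphism \<open>\<phi>\<close> between open sets of the ambient space that
  maps \<open>M \<inter> V\<close> onto an open subset of \<open>R^D\<close>, the coordinate space of a set \<open>D\<close> of \<open>d = card D\<close>
  coordinates. Its restriction to \<open>U = M \<inter> V\<close> is a chart \<open>(U, \<psi>)\<close> of \<open>M\<close>, the differential of
  \<open>\<psi>\<close> at \<open>x\<close> is the restriction of the differential of \<open>\<phi>\<close> to the tangent space, and every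
  chart of \<open>M\<close> is near each of its points the restriction of a slice chart.
\<close>

definition slice_chart ::
  "(real^'c) set \<Rightarrow> 'c set \<Rightarrow> (real^'c) set \<Rightarrow> (real^'c \<Rightarrow> real^'c) \<Rightarrow> bool" where
  "slice_chart M D V \<phi> \<longleftrightarrow>
     open V \<and> open (\<phi> ` V) \<and> inj_on \<phi> V \<and> smooth_on \<phi> V \<and> smooth_on (inv_into V \<phi>) (\<phi> ` V) \<and>
     \<phi> ` (M \<inter> V) = \<phi> ` V \<inter> coord_space D"

definition embedded_submanifold :: "(real^'c) set \<Rightarrow> bool" where
  "embedded_submanifold M \<longleftrightarrow>
     (\<exists>d. \<forall>x\<in>M. \<exists>D V \<phi>. card D = d \<and> slice_chart M D V \<phi> \<and> x \<in> V)"

definition tangent_space :: "(real^'c) set \<Rightarrow> real^'c \<Rightarrow> (real^'c) set" where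
  "tangent_space M x =
     {v. \<exists>\<gamma> \<delta>. \<delta> > 0 \<and> smooth_on \<gamma> {-\<delta><..<\<delta>} \<and> (\<forall>t\<in>{-\<delta><..<\<delta>}. \<gamma> t \<in> M) \<and> \<gamma> 0 = x \<and>
        (\<gamma> has_vector_derivative v) (at (0::real))}"

definition clarke_tangent_cone :: "'a::real_normed_vector set \<Rightarrow> 'a \<Rightarrow> 'a set" where
  "clarke_tangent_cone C x =
     {w. \<forall>xs t. (\<forall>j. xs j \<in> C) \<and> xs \<longlonglongrightarrow> x \<and> (\<forall>j. t j > 0) \<and> decseq t \<and> t \<longlonglongrightarrow> 0 \<longrightarrow>
           (\<exists>ws. ws \<longlonglongrightarrow> w \<and> (\<forall>j::nat. xs j + t j *\<^sub>R ws j \<in> C))}"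

text \<open>
  The cones of a relatively closed set \<open>S \<subseteq> M\<close>, computed in the slice chart \<open>(V, \<phi>)\<close>; note that
  \<open>S \<inter> (M \<inter> V) = S \<inter> V\<close>.
\<close>

definition mfd_tangent_cone ::
  "(real^'c) set \<Rightarrow> (real^'c) set \<Rightarrow> (real^'c) set \<Rightarrow> (real^'c \<Rightarrow> real^'c) \<Rightarrow> real^'c \<Rightarrow> (real^'c) set"
where
  "mfd_tangent_cone M S V \<phi> x =
     {v \<in> tangent_space M x.
        frechet_derivative \<phi> (at x) v \<in> clarke_tangent_cone (\<phi> ` (S \<inter> V)) (\<phi> x)}"

definition mfd_normal_cone ::
  "(real^'c) set \<Rightarrow> (real^'c) set \<Rightarrow> (real^'c) set \<Rightarrow> (real^'c \<Rightarrow> real^'c) \<Rightarrow> real^'c \<Rightarrow> (real^'c) set"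
where
  "mfd_normal_cone M S V \<phi> x =
     {u \<in> tangent_space M x. \<forall>v\<in>mfd_tangent_cone M S V \<phi> x. u \<bullet> v \<le> 0}"

section \<open>Matrices acting on a coordinate block\<close>

text \<open>
  A matrix of an operator on the block \<open>E = coord_space D\<close> is stored in a matrix over all of
  \<open>'c\<close>, with zero entries outside the block; \<open>E\<close> is the space on which definiteness and singular
  values are understood.
\<close>

definition pos_def_on :: "(real^'c) set \<Rightarrow> real^'c^'c \<Rightarrow> bool" where
  "pos_def_on E H \<longleftrightarrow> transpose H = H \<and> (\<forall>v\<in>E. v \<noteq> 0 \<longrightarrow> v \<bullet> (H *v v) > 0)"

definition singular_values_on :: "(real^'c) set \<Rightarrow> real^'c^'c \<Rightarrow> real set" where
  "singular_values_on E H =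
     {sqrt \<mu> |\<mu>. \<exists>v\<in>E. v \<noteq> 0 \<and> (transpose H ** H) *v v = \<mu> *\<^sub>R v}"

definition sigma_min_on :: "(real^'c) set \<Rightarrow> real^'c^'c \<Rightarrow> real" where
  "sigma_min_on E H = Min (singular_values_on E H)"

abbreviation mat_norm2 :: "real^'n^'k \<Rightarrow> real" where
  "mat_norm2 B \<equiv> onorm ((*v) B)"

section \<open>The optimization problem\<close>

text \<open>
  The data of problem (P). The matrices \<open>A\<^sub>i\<close> with \<open>i < N\<close> are stored in \<open>cmat P i\<close>
  with zero columns outside block \<open>i\<close>; \<open>A\<^sub>N\<close> is the identity \<open>mat 1\<close> on \<open>real^'m\<close>.
\<close>

record ('c, 'm) problem =
  nblocks :: nat
  block_of :: "'c \<Rightarrow> nat"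
  obj :: "(real^'c) \<times> (real^'m) \<Rightarrow> real"
  reg :: "nat \<Rightarrow> real^'c \<Rightarrow> real"
  mfd :: "nat \<Rightarrow> (real^'c) set"
  cvx :: "nat \<Rightarrow> (real^'c) set"
  cmat :: "nat \<Rightarrow> real^'c^'m"
  rhs :: "real^'m"

abbreviation coords :: "('c::finite, 'm::finite) problem \<Rightarrow> nat \<Rightarrow> 'c set" where
  "coords P i \<equiv> {c. block_of P c = i}"

definition block_space :: "('c::finite, 'm::finite) problem \<Rightarrow> nat \<Rightarrow> (real^'c) set" where
  "block_space P i = coord_space (coords P i)"

definition block :: "('c::finite, 'm::finite) problem \<Rightarrow> nat \<Rightarrow> real^'c \<Rightarrow> real^'c" where
  "block P i x = coord_proj (coords P i) x"

definition feasible_blocks :: "('c::finite, 'm::finite) problem \<Rightarrow> (real^'c) set" where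
  "feasible_blocks P = {x. \<forall>i\<in>{1..nblocks P - 1}. block P i x \<in> mfd P i \<inter> cvx P i}"

definition reg_opt :: "('c::finite, 'm::finite) problem \<Rightarrow> nat \<Rightarrow> real" where
  "reg_opt P i = (INF v\<in>mfd P i \<inter> cvx P i. reg P i v)"

definition obj_opt :: "('c::finite, 'm::finite) problem \<Rightarrow> real" where
  "obj_opt P = (INF z\<in>feasible_blocks P \<times> UNIV. obj P z)"

definition standing_assumptions :: "('c::finite, 'm::finite) problem \<Rightarrow> real \<Rightarrow> bool" where
  "standing_assumptions P L \<longleftrightarrow>
     nblocks P \<ge> 2 \<and> range (block_of P) = {1..nblocks P - 1} \<and>
     L > 0 \<and> (\<forall>z. \<exists>D. GDERIV (obj P) z :> D) \<and> L-lipschitz_on UNIV (grad (obj P)) \<and>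
     (\<forall>i\<in>{1..nblocks P - 1}.
        convex_on (block_space P i) (reg P i) \<and>
        locally_lipschitz_on (block_space P i) (reg P i) \<and>
        mfd P i \<subseteq> block_space P i \<and> embedded_submanifold (mfd P i) \<and>
        cvx P i \<subseteq> block_space P i \<and> closed (cvx P i) \<and> convex (cvx P i) \<and>
        (\<forall>j c. c \<notin> coords P i \<longrightarrow> cmat P i $ j $ c = 0) \<and>
        bdd_below (reg P i ` (mfd P i \<inter> cvx P i))) \<and>
     bdd_below (obj P ` (feasible_blocks P \<times> UNIV))"

definition residual :: "('c::finite, 'm::finite) problem \<Rightarrow> real^'c \<Rightarrow> real^'m \<Rightarrow> real^'m" where
  "residual P x y = (\<Sum>i=1..nblocks P - 1. cmat P i *v block P i x) + mat 1 *v y - rhs P"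

definition aug_lag ::
  "('c::finite, 'm::finite) problem \<Rightarrow> real \<Rightarrow> real^'c \<Rightarrow> real^'m \<Rightarrow> real^'m \<Rightarrow> real" where
  "aug_lag P \<beta> x y lam =
     obj P (x, y) + (\<Sum>i=1..nblocks P - 1. reg P i (block P i x))
       - residual P x y \<bullet> lam + \<beta> / 2 * (norm (residual P x y))\<^sup>2"

definition potential ::
  "('c::finite, 'm::finite) problem \<Rightarrow> real \<Rightarrow> real \<Rightarrow> real \<Rightarrow>
     real^'c \<Rightarrow> real^'m \<Rightarrow> real^'m \<Rightarrow> real^'m \<Rightarrow> real" where
  "potential P L \<beta> \<gamma> x y lam ybar =
     aug_lag P \<beta> x y lam + 3 / \<beta> * ((\<beta> - 1 / \<gamma>)\<^sup>2 + L\<^sup>2) * (norm (ybar - y))\<^sup>2"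

section \<open>The algorithm\<close>

text \<open>The point \<open>(u\<^sub>1, \<dots>, u\<^sub>i\<^sub>-\<^sub>1, w, v\<^sub>i\<^sub>+\<^sub>1, \<dots>, v\<^sub>N\<^sub>-\<^sub>1)\<close>.\<close>

definition sweep ::
  "('c::finite, 'm::finite) problem \<Rightarrow> nat \<Rightarrow> real^'c \<Rightarrow> real^'c \<Rightarrow> real^'c \<Rightarrow> real^'c" where
  "sweep P i u w v =
     (\<chi> c. if block_of P c < i then u $ c else if block_of P c = i then w $ c else v $ c)"

text \<open>
  The iterates are \<open>x k\<close> (the blocks \<open>1, \<dots>, N - 1\<close>), \<open>y k\<close> (the block \<open>N\<close>) and
  \<open>lam k\<close>.
\<close>

definition generated_by_algorithm ::
  "('c::finite, 'm::finite) problem \<Rightarrow> real \<Rightarrow> real \<Rightarrow> (nat \<Rightarrow> real^'c^'c) \<Rightarrow>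
     (nat \<Rightarrow> real^'c) \<Rightarrow> (nat \<Rightarrow> real^'m) \<Rightarrow> (nat \<Rightarrow> real^'m) \<Rightarrow> bool" where
  "generated_by_algorithm P \<beta> \<gamma> H x y lam \<longleftrightarrow>
     \<beta> > 0 \<and> \<gamma> > 0 \<and>
     (\<forall>i\<in>{1..nblocks P - 1}.
        (\<forall>c d. c \<notin> coords P i \<or> d \<notin> coords P i \<longrightarrow> H i $ c $ d = 0) \<and>
        pos_def_on (block_space P i) (H i)) \<and>
     x 0 \<in> feasible_blocks P \<and>
     (\<forall>k.
        (\<forall>i\<in>{1..nblocks P - 1}.
           is_arg_min
             (\<lambda>w. aug_lag P \<beta> (sweep P i (x (Suc k)) w (x k)) (y k) (lam k)
                  + 1 / 2 * ((w - block P i (x k)) \<bullet> (H i *v (w - block P i (x k)))))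
             (\<lambda>w. w \<in> mfd P i \<inter> cvx P i)
             (block P i (x (Suc k)))) \<and>
        y (Suc k) = y k - \<gamma> *\<^sub>R grad (\<lambda>u. aug_lag P \<beta> (x (Suc k)) u (lam k)) (y k) \<and>
        lam (Suc k) = lam k - \<beta> *\<^sub>R residual P (x (Suc k)) (y (Suc k)))"

section \<open>Approximate stationarity\<close>

text \<open>
  The normal cone does not depend on the chart; the condition is required for every slice chart at
  the point, so that no choice of a chart is involved. Both arguments of \<open>setdist\<close> are nonempty:
  the subdifferential of a convex function on \<open>R^n\<^sub>i\<close> is nonempty, and the normal cone
  contains \<open>0\<close>.
\<close>

definition eps_stationary ::
  "('c::finite, 'm::finite) problem \<Rightarrow> real \<Rightarrow> real^'c \<Rightarrow> real^'m \<Rightarrow> real^'m \<Rightarrow> bool" where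
  "eps_stationary P \<epsilon> x y lam \<longleftrightarrow>
     norm (snd (grad (obj P) (x, y)) - transpose (mat 1) *v lam) \<le> \<epsilon> \<and>
     norm (residual P x y) \<le> \<epsilon> \<and>
     (\<forall>i\<in>{1..nblocks P - 1}.
        block P i x \<in> mfd P i \<inter> cvx P i \<and>
        (\<forall>D V \<phi>. slice_chart (mfd P i) D V \<phi> \<and> block P i x \<in> V \<longrightarrow>
           setdist
             (orth_proj (tangent_space (mfd P i) (block P i x)) `
                {- block P i (fst (grad (obj P) (x, y))) + transpose (cmat P i) *v lam - g |g.
                   g \<in> subdiff (block_space P i) (reg P i) (block P i x)})
             (mfd_normal_cone (mfd P i) (cvx P i \<inter> mfd P i) V \<phi> (block P i x)) \<le> \<epsilon>))"

end

theory Submission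
  imports Defs
begin

text \<open>
  The multiplier satisfies \<open>\<lambda>\<^sup>k\<^sup>+\<^sup>1 = \<nabla>\<^sub>N f + (\<beta> - 1/\<gamma>) (x\<^sub>N\<^sup>k - x\<^sub>N\<^sup>k\<^sup>+\<^sup>1)\<close>, so its
  increments are controlled by two consecutive primal steps, and the potential drops by at least
  \<open>\<tau>\<close> times the squared primal step. It is bounded below: the augmented
  Lagrangian exceeds \<open>\<Sum>r\<^sub>i\<^sup>* + f\<^sup>*\<close> up to the telescoping term
  \<open>(\<parallel>\<lambda>\<^sup>k\<^sup>+\<^sup>1\<parallel>\<^sup>2 - \<parallel>\<lambda>\<^sup>k\<parallel>\<^sup>2) / (2\<beta>)\<close>. Hence some pair of consecutive steps among the first \<open>K + 1\<close> is short, and the three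
  residuals of the stationarity system are each at most a constant times its length. For the blocks on
  manifolds this uses the first-order optimality of the global minimizer: a tangent vector in the
  Clarke cone is a limit of feasible directions, the cone is convex, and orthogonal projection onto the
  tangent space is nonexpansive.
\<close>

section \<open>Tangent spaces of embedded submanifolds\<close>

text \<open>The gradient step for the last block evaluates the gradient of \<open>f\<close> at the
  old \<open>y k\<close>, so a multiplier increment also involves the last-block step of the
  preceding iteration. The decrease of the augmented Lagrangian in the current iteration offers
  nothing against that term; the extra summand of the potential cancels it, and this dictates its
  coefficient. For the blocks on manifolds the obstacle is that the regularizer is nonsmooth while
  the feasible set is nonconvex. Minimality is therefore passed to the tangent cone with the
  regularizer replaced by its increment \<open>r (x + v) - r x\<close>. That leaves a convex
  function on a convex cone, from which separation extracts one subgradient that serves all tangent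
  directions simultaneously. Tangent spaces are given by curves and cones by charts, so both are
  first brought into the linear picture of a slice chart.\<close>

lemma Ck_on_cong:
  assumes "open S" "\<And>x. x \<in> S \<Longrightarrow> f x = g x" "Ck_on k f S"
  shows "Ck_on k g S"
  using assms(2,3)
proof (induction k arbitrary: f g)
  case 0
  then show ?case by (simp cong: continuous_on_cong)
next
  case (Suc k)
  have der: "(g has_derivative frechet_derivative f (at x)) (at x)" if "x \<in> S" for x
    using has_derivative_transform_within_open[of f _ x UNIV S g] Suc.prems that assms(1)
    by (auto simp: frechet_derivative_works)
  then have eq: "frechet_derivative f (at x) = frechet_derivative g (at x)" if "x \<in> S" for x
    using that frechet_derivative_at by blast
  have "Ck_on k (\<lambda>x. frechet_derivative g (at x) v) S" for v
    using Suc.IH[of "\<lambda>x. frechet_derivative f (at x) v"] Suc.prems eq by auto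
  moreover have "g differentiable (at x)" if "x \<in> S" for x
    using der[OF that] by (auto simp: differentiable_def)
  ultimately show ?case by simp
qed

text \<open>The curves that realize tangent vectors are straight lines of a chart pulled back to the
  manifold. Differentiating along a line gives a derivative of \<open>f\<close> in a fixed
  direction, composed with the same line, so the induction closes.\<close>

lemma Ck_on_line:
  fixes a b :: "'a::real_normed_vector"
  assumes "open T" "\<And>t. t \<in> T \<Longrightarrow> a + t *\<^sub>R b \<in> S" "Ck_on k f S"
  shows "Ck_on k (\<lambda>t::real. f (a + t *\<^sub>R b)) T"
  using assms(3)
proof (induction k arbitrary: f)
  case 0
  then show ?case
    by (auto intro!: continuous_on_compose2[of S f] continuous_intros simp: assms(2))
next
  case (Suc k)
  have der: "((\<lambda>t. f (a + t *\<^sub>R b)) has_derivative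
      (\<lambda>s. frechet_derivative f (at (a + t *\<^sub>R b)) (s *\<^sub>R b))) (at t)" if "t \<in> T" for t
  proof -
    have "(f has_derivative frechet_derivative f (at (a + t *\<^sub>R b))) (at (a + t *\<^sub>R b))"
      using Suc.prems assms(2)[OF that] by (auto simp: frechet_derivative_works)
    moreover have "((\<lambda>t. a + t *\<^sub>R b) has_derivative (\<lambda>s. s *\<^sub>R b)) (at t)"
      by (auto intro!: derivative_eq_intros)
    ultimately show ?thesis
      using has_derivative_compose by blast
  qed
  have eq: "frechet_derivative (\<lambda>t. f (a + t *\<^sub>R b)) (at t) =
      (\<lambda>s. frechet_derivative f (at (a + t *\<^sub>R b)) (s *\<^sub>R b))" if "t \<in> T" for t
    using frechet_derivative_at[OF der[OF that]] by simp
  have "Ck_on k (\<lambda>t. frechet_derivative (\<lambda>t. f (a + t *\<^sub>R b)) (at t) s) T" for s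
    by (rule Ck_on_cong[OF assms(1), of "\<lambda>t. frechet_derivative f (at (a + t *\<^sub>R b)) (s *\<^sub>R b)"])
       (use eq Suc in auto)
  then show ?case
    using der by (auto simp: differentiable_def)
qed

lemma smooth_on_has_derivative:
  assumes "smooth_on f S" "x \<in> S"
  shows "(f has_derivative frechet_derivative f (at x)) (at x)"
proof -
  have "Ck_on (Suc 0) f S" using assms(1) by (auto simp: smooth_on_def)
  then show ?thesis using assms(2) by (auto simp: frechet_derivative_works)
qed

lemma subspace_coord_space: "subspace (coord_space D)"
  by (auto simp: subspace_def coord_space_def)

lemma slice_chart_derivative:
  assumes "slice_chart M D V \<phi>" "x \<in> V"
  shows "(\<phi> has_derivative frechet_derivative \<phi> (at x)) (at x)"
    and "(inv_into V \<phi> has_derivative frechet_derivative (inv_into V \<phi>) (at (\<phi> x))) (at (\<phi> x))"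
    and "frechet_derivative (inv_into V \<phi>) (at (\<phi> x)) (frechet_derivative \<phi> (at x) v) = v"
proof -
  let ?\<psi> = "inv_into V \<phi>"
  show 1: "(\<phi> has_derivative frechet_derivative \<phi> (at x)) (at x)"
    using assms by (intro smooth_on_has_derivative[of \<phi> V]) (auto simp: slice_chart_def)
  show 2: "(?\<psi> has_derivative frechet_derivative ?\<psi> (at (\<phi> x))) (at (\<phi> x))"
    using assms by (intro smooth_on_has_derivative[of ?\<psi> "\<phi> ` V"]) (auto simp: slice_chart_def)
  have "((\<lambda>z. ?\<psi> (\<phi> z)) has_derivative
      (\<lambda>v. frechet_derivative ?\<psi> (at (\<phi> x)) (frechet_derivative \<phi> (at x) v))) (at x)"
    using has_derivative_compose[OF 1 2] .
  moreover have "((\<lambda>z. ?\<psi> (\<phi> z)) has_derivative (\<lambda>v. v)) (at x)"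
    by (rule has_derivative_transform_within_open[of "\<lambda>z. z" _ x UNIV V])
       (use assms in \<open>auto simp: slice_chart_def\<close>)
  ultimately show "frechet_derivative ?\<psi> (at (\<phi> x)) (frechet_derivative \<phi> (at x) v) = v"
    using has_derivative_unique[of _ _ x] by (metis (lifting))
qed

text \<open>Linearity is not visible in the definition by curves. In a chart, a curve in
  \<open>M\<close> has vanishing coordinates outside \<open>D\<close>, hence so does its velocity;
  conversely a line inside \<open>coord_space D\<close> pulls back to a curve in
  \<open>M\<close>.\<close>

lemma tangent_space_eq:
  assumes chart: "slice_chart M D V \<phi>" and x: "x \<in> M" "x \<in> V"
  shows "tangent_space M x = {v. frechet_derivative \<phi> (at x) v \<in> coord_space D}"
proof (intro equalityI subsetI CollectI)
  note der = slice_chart_derivative[OF chart x(2)]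
  have V: "open V" "\<phi> ` (M \<inter> V) = \<phi> ` V \<inter> coord_space D"
    using chart by (auto simp: slice_chart_def)
  fix v assume "v \<in> tangent_space M x"
  then obtain \<gamma> \<delta> where g: "\<delta> > 0" "\<And>t. t \<in> {-\<delta><..<\<delta>} \<Longrightarrow> \<gamma> t \<in> M" "\<gamma> 0 = x"
      "(\<gamma> has_vector_derivative v) (at (0::real))"
    unfolding tangent_space_def by blast
  have d: "((\<lambda>t. \<phi> (\<gamma> t)) has_derivative (\<lambda>t. frechet_derivative \<phi> (at x) (t *\<^sub>R v))) (at 0)"
    using has_derivative_compose[OF g(4)[unfolded has_vector_derivative_def], of \<phi>
        "frechet_derivative \<phi> (at x)"] der(1) g(3) by simp
  have "isCont \<gamma> 0" using g(4) has_vector_derivative_continuous by blast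
  then have "\<forall>\<^sub>F t in at 0. \<gamma> t \<in> V"
    using V(1) x(2) g(3) by (metis isCont_def topological_tendstoD)
  moreover have "\<forall>\<^sub>F t in at (0::real). t \<in> {-\<delta><..<\<delta>}"
    using g(1) by (intro eventually_at_in_open') auto
  ultimately have "\<forall>\<^sub>F t in at 0. \<phi> (\<gamma> t) \<in> coord_space D"
    by eventually_elim (use g(2) V(2) in blast)
  \<comment> \<open>The comparison with a constant function happens on an open set around 0, so the
    point that \<open>at 0\<close> leaves out must be included.\<close>
  then have ev: "\<forall>\<^sub>F t in nhds 0. \<phi> (\<gamma> t) \<in> coord_space D"
    unfolding eventually_nhds_conv_at using x V(2) g(3) by auto
  show "frechet_derivative \<phi> (at x) v \<in> coord_space D"
    unfolding coord_space_def
  proof (intro CollectI allI impI)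
    fix c assume c: "c \<notin> D"
    have "((\<lambda>t. \<phi> (\<gamma> t) $ c) has_derivative (\<lambda>t. frechet_derivative \<phi> (at x) (t *\<^sub>R v) $ c)) (at 0)"
      by (rule bounded_linear.has_derivative[OF bounded_linear_vec_nth d])
    moreover have "((\<lambda>t. \<phi> (\<gamma> t) $ c) has_derivative (\<lambda>t. 0)) (at 0)"
    proof -
      obtain U where U: "open U" "(0::real) \<in> U" "\<And>t. t \<in> U \<Longrightarrow> \<phi> (\<gamma> t) \<in> coord_space D"
        using ev by (auto simp: eventually_nhds)
      show ?thesis
        by (rule has_derivative_transform_within_open[of "\<lambda>t. 0" _ _ _ U])
           (use U c in \<open>auto simp: coord_space_def\<close>)
    qed
    ultimately have "(\<lambda>t. frechet_derivative \<phi> (at x) (t *\<^sub>R v) $ c) = (\<lambda>t::real. 0)"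
      using has_derivative_unique by blast
    from fun_cong[OF this, of 1] show "frechet_derivative \<phi> (at x) v $ c = 0" by simp
  qed
next
  note der = slice_chart_derivative[OF chart x(2)]
  let ?\<psi> = "inv_into V \<phi>"
  have V: "open (\<phi> ` V)" "\<phi> ` (M \<inter> V) = \<phi> ` V \<inter> coord_space D" "inj_on \<phi> V"
      "smooth_on ?\<psi> (\<phi> ` V)"
    using chart by (auto simp: slice_chart_def)
  fix v assume "v \<in> {v. frechet_derivative \<phi> (at x) v \<in> coord_space D}"
  then have v: "frechet_derivative \<phi> (at x) v \<in> coord_space D" by simp
  let ?w = "frechet_derivative \<phi> (at x) v"
  have "open ((\<lambda>t::real. \<phi> x + t *\<^sub>R ?w) -` (\<phi> ` V))"
    by (intro open_vimage V continuous_intros)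
  moreover have "0 \<in> (\<lambda>t::real. \<phi> x + t *\<^sub>R ?w) -` (\<phi> ` V)" using x by simp
  ultimately obtain \<delta> where d: "\<delta> > 0" "ball 0 \<delta> \<subseteq> (\<lambda>t::real. \<phi> x + t *\<^sub>R ?w) -` (\<phi> ` V)"
    using open_contains_ball by blast
  have inV: "\<phi> x + t *\<^sub>R ?w \<in> \<phi> ` V" if "t \<in> {-\<delta><..<\<delta>}" for t
    using d(2) that by (auto simp: subset_iff dist_real_def)
  have "\<phi> x \<in> coord_space D" using x V(2) by blast
  then have "\<phi> x + t *\<^sub>R ?w \<in> coord_space D" for t
    using v by (simp add: subspace_add subspace_mul subspace_coord_space)
  then have "\<phi> x + t *\<^sub>R ?w \<in> \<phi> ` (M \<inter> V)" if "t \<in> {-\<delta><..<\<delta>}" for t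
    using inV[OF that] V(2) by blast
  then have "?\<psi> (\<phi> x + t *\<^sub>R ?w) \<in> M" if "t \<in> {-\<delta><..<\<delta>}" for t
    using that V(3) by fastforce
  moreover have "smooth_on (\<lambda>t. ?\<psi> (\<phi> x + t *\<^sub>R ?w)) {-\<delta><..<\<delta>}"
    using V(4) inV unfolding smooth_on_def
    by (intro allI Ck_on_line[of _ _ _ "\<phi> ` V"]) auto
  moreover have "?\<psi> (\<phi> x + 0 *\<^sub>R ?w) = x" using V(3) x by simp
  moreover have "((\<lambda>t. ?\<psi> (\<phi> x + t *\<^sub>R ?w)) has_vector_derivative v) (at 0)"
  proof -
    have "((\<lambda>t. \<phi> x + t *\<^sub>R ?w) has_derivative (\<lambda>t. t *\<^sub>R ?w)) (at 0)"
      by (auto intro!: derivative_eq_intros)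
    from has_derivative_compose[OF this, of ?\<psi> "frechet_derivative ?\<psi> (at (\<phi> x))"]
    have "((\<lambda>t. ?\<psi> (\<phi> x + t *\<^sub>R ?w)) has_derivative
        (\<lambda>t. frechet_derivative ?\<psi> (at (\<phi> x)) (t *\<^sub>R ?w))) (at 0)"
      using der(2) by simp
    then show ?thesis
      using der(3) linear_cmul[OF has_derivative_linear[OF der(2)]]
      by (simp add: has_vector_derivative_def)
  qed
  ultimately show "v \<in> tangent_space M x"
    unfolding tangent_space_def using d(1) by blast
qed

lemma subspace_tangent_space:
  assumes "embedded_submanifold M" "x \<in> M"
  shows "subspace (tangent_space M x)"
proof -
  obtain D V \<phi> where c: "slice_chart M D V \<phi>" "x \<in> V"
    using assms unfolding embedded_submanifold_def by metis
  have "linear (frechet_derivative \<phi> (at x))"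
    using slice_chart_derivative(1)[OF c] has_derivative_linear by blast
  then show ?thesis
    using tangent_space_eq[OF c(1) assms(2) c(2)] linear_subspace_linear_preimage[OF _ subspace_coord_space]
    by simp
qed

section \<open>First-order optimality on a manifold\<close>

lemma zero_mem_clarke_tangent_cone: "0 \<in> clarke_tangent_cone C x"
  unfolding clarke_tangent_cone_def by (auto intro!: exI[of _ "\<lambda>_. 0"])

text \<open>The definition admits every base sequence in \<open>C\<close>. The condition for
  \<open>w\<close> may thus be applied at the shifted points
  \<open>xs j + t j *\<^sub>R vs j\<close>, which lie in \<open>C\<close> and still tend to
  \<open>x\<close>. This is where the Clarke cone gets its convexity.\<close>

lemma clarke_tangent_cone_add:
  assumes "v \<in> clarke_tangent_cone C x" "w \<in> clarke_tangent_cone C x"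
  shows "v + w \<in> clarke_tangent_cone C x"
  unfolding clarke_tangent_cone_def
proof (intro CollectI allI impI)
  fix xs and t :: "nat \<Rightarrow> real"
  assume a: "(\<forall>j. xs j \<in> C) \<and> xs \<longlonglongrightarrow> x \<and> (\<forall>j. t j > 0) \<and> decseq t \<and> t \<longlonglongrightarrow> 0"
  then obtain vs where vs: "vs \<longlonglongrightarrow> v" "\<And>j. xs j + t j *\<^sub>R vs j \<in> C"
    using assms(1) unfolding clarke_tangent_cone_def by blast
  have "(\<lambda>j. xs j + t j *\<^sub>R vs j) \<longlonglongrightarrow> x + 0 *\<^sub>R v"
    using a vs(1) by (intro tendsto_intros) auto
  with a vs(2) obtain ws where ws: "ws \<longlonglongrightarrow> w"
      "\<And>j. (xs j + t j *\<^sub>R vs j) + t j *\<^sub>R ws j \<in> C"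
    using assms(2) unfolding clarke_tangent_cone_def
    by (auto dest!: spec[of _ "\<lambda>j. xs j + t j *\<^sub>R vs j"] spec[of _ t])
  have "(\<lambda>j. vs j + ws j) \<longlonglongrightarrow> v + w" using vs(1) ws(1) by (rule tendsto_add)
  then show "\<exists>us. us \<longlonglongrightarrow> v + w \<and> (\<forall>j. xs j + t j *\<^sub>R us j \<in> C)"
    using ws(2) by (intro exI[of _ "\<lambda>j. vs j + ws j"]) (auto simp: scaleR_add_right add.assoc)
qed

text \<open>A step \<open>t j\<close> along \<open>s *\<^sub>R v\<close> is a step
  \<open>s * t j\<close> along \<open>v\<close>.\<close>

lemma clarke_tangent_cone_scale:
  assumes "v \<in> clarke_tangent_cone C x" "s \<ge> 0"
  shows "s *\<^sub>R v \<in> clarke_tangent_cone C x"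
proof (cases "s = 0")
  case True
  then show ?thesis by (simp add: zero_mem_clarke_tangent_cone)
next
  case False
  then have s: "s > 0" using assms by simp
  show ?thesis
    unfolding clarke_tangent_cone_def
  proof (intro CollectI allI impI)
    fix xs and t :: "nat \<Rightarrow> real"
    assume a: "(\<forall>j. xs j \<in> C) \<and> xs \<longlonglongrightarrow> x \<and> (\<forall>j. t j > 0) \<and> decseq t \<and> t \<longlonglongrightarrow> 0"
    have "decseq (\<lambda>j. s * t j)" using a s by (simp add: monotone_def)
    moreover have "(\<lambda>j. s * t j) \<longlonglongrightarrow> 0" using a tendsto_mult_right_zero by blast
    ultimately obtain vs where vs: "vs \<longlonglongrightarrow> v" "\<And>j. xs j + (s * t j) *\<^sub>R vs j \<in> C"
      using assms(1) a s unfolding clarke_tangent_cone_def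
      by (auto dest!: spec[of _ xs] spec[of _ "\<lambda>j. s * t j"])
    have "(\<lambda>j. s *\<^sub>R vs j) \<longlonglongrightarrow> s *\<^sub>R v" by (intro tendsto_intros vs)
    then show "\<exists>us. us \<longlonglongrightarrow> s *\<^sub>R v \<and> (\<forall>j. xs j + t j *\<^sub>R us j \<in> C)"
      using vs(2) by (intro exI[of _ "\<lambda>j. s *\<^sub>R vs j"]) (auto simp: mult.commute)
  qed
qed

text \<open>Tangent directions are only limits of feasible ones, so difference quotients are needed
  along directions that vary with the step.\<close>

lemma has_derivative_sequential_direction:
  assumes f: "(f has_derivative f') (at a)"
    and t: "\<And>j. t j > (0::real)" "t \<longlonglongrightarrow> 0" and w: "ws \<longlonglongrightarrow> w"
  shows "(\<lambda>j. (f (a + t j *\<^sub>R ws j) - f a) /\<^sub>R t j) \<longlonglongrightarrow> f' w"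
proof -
  interpret bounded_linear f' using f by (rule has_derivative_bounded_linear)
  \<comment> \<open>The normalized remainder. Since the inverse of 0 is 0, it vanishes at
    \<open>a\<close> and is continuous there, so sequences that hit \<open>a\<close> are
    covered.\<close>
  define E where "E y = (f y - f a - f' (y - a)) /\<^sub>R norm (y - a)" for y
  have "(E \<longlongrightarrow> 0) (at a)"
    using f unfolding has_derivative_at_within E_def[abs_def] by simp
  then have "isCont E a" by (simp add: isCont_def E_def)
  moreover have "(\<lambda>j. a + t j *\<^sub>R ws j) \<longlonglongrightarrow> a"
    using tendsto_add[OF tendsto_const tendsto_scaleR[OF t(2) w], of a] by simp
  ultimately have "(\<lambda>j. E (a + t j *\<^sub>R ws j)) \<longlonglongrightarrow> E a"
    by (rule isCont_tendsto_compose)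
  then have "(\<lambda>j. norm (ws j) *\<^sub>R E (a + t j *\<^sub>R ws j) + f' (ws j)) \<longlonglongrightarrow> norm w *\<^sub>R E a + f' w"
    by (intro tendsto_intros w tendsto)
  moreover have "norm (ws j) *\<^sub>R E (a + t j *\<^sub>R ws j) + f' (ws j) =
      (f (a + t j *\<^sub>R ws j) - f a) /\<^sub>R t j" for j
  proof (cases "ws j = 0")
    case True
    then show ?thesis by (simp add: zero)
  next
    case False
    have "norm (ws j) *\<^sub>R E (a + t j *\<^sub>R ws j) =
        (f (a + t j *\<^sub>R ws j) - f a - t j *\<^sub>R f' (ws j)) /\<^sub>R t j"
      using t(1)[of j] False by (simp add: E_def scaleR)
    also have "\<dots> = (f (a + t j *\<^sub>R ws j) - f a) /\<^sub>R t j - f' (ws j)"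
      using t(1)[of j] by (simp add: scaleR_right_diff_distrib)
    finally show ?thesis by simp
  qed
  ultimately show ?thesis by (simp add: E_def)
qed

text \<open>The Clarke condition in the chart is used with the constant base sequence \<phi> x; the
  inverse chart carries the resulting points back to \<open>S\<close>.\<close>

lemma mfd_tangent_cone_sequence:
  assumes chart: "slice_chart M D V \<phi>" and x: "x \<in> S" "x \<in> V"
    and v: "v \<in> mfd_tangent_cone M S V \<phi> x"
    and t: "\<And>j. t j > (0::real)" "decseq t" "t \<longlonglongrightarrow> 0"
  obtains vs where "vs \<longlonglongrightarrow> v" "\<And>j. x + t j *\<^sub>R vs j \<in> S"
proof -
  let ?\<psi> = "inv_into V \<phi>"
  note der = slice_chart_derivative[OF chart x(2)]
  have inj: "inj_on \<phi> V" using chart by (simp add: slice_chart_def)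
  obtain ws where ws: "ws \<longlonglongrightarrow> frechet_derivative \<phi> (at x) v"
      "\<And>j. \<phi> x + t j *\<^sub>R ws j \<in> \<phi> ` (S \<inter> V)"
    using v x t unfolding mfd_tangent_cone_def clarke_tangent_cone_def
    by (auto dest!: spec[of _ "\<lambda>_. \<phi> x"] spec[of _ t])
  \<comment> \<open>Chosen so that \<open>x + t j *\<^sub>R vs j\<close> is exactly the pulled-back
    point. The limit is the derivative of the inverse chart applied to that of the chart, which
    returns \<open>v\<close>.\<close>
  define vs where "vs j = (?\<psi> (\<phi> x + t j *\<^sub>R ws j) - ?\<psi> (\<phi> x)) /\<^sub>R t j" for j
  have "vs \<longlonglongrightarrow> v"
    using has_derivative_sequential_direction[OF der(2) t(1,3) ws(1)] der(3)
    by (simp add: vs_def[abs_def])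
  moreover have "x + t j *\<^sub>R vs j \<in> S" for j
    using ws(2)[of j] inj x t(1)[of j] by (auto simp: vs_def)
  ultimately show ?thesis using that by blast
qed

lemma coord_proj_add: "coord_proj B (u + v) = coord_proj B u + coord_proj B v"
  and coord_proj_scaleR: "coord_proj B (s *\<^sub>R v) = s *\<^sub>R coord_proj B v"
  and coord_proj_in: "coord_proj B v \<in> coord_space B"
  and coord_proj_id: "v \<in> coord_space B \<Longrightarrow> coord_proj B v = v"
  by (auto simp: coord_proj_def coord_space_def vec_eq_iff)

text \<open>Minimality is tested at the feasible points \<open>x + t j *\<^sub>R vs j\<close>. The
  local Lipschitz bound exchanges \<open>vs j\<close> for \<open>v\<close> in \<open>r\<close> at a
  relative cost \<open>C * norm (vs j - v)\<close>, and convexity bounds the remaining difference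
  quotient of \<open>r\<close> by \<open>r (x + v) - r x\<close>.\<close>

lemma minimizer_linearization:
  fixes r h :: "real^'c \<Rightarrow> real"
  assumes chart: "slice_chart M D V \<phi>" and S: "S \<subseteq> coord_space B" and x: "x \<in> S" "x \<in> V"
    and r: "convex_on (coord_space B) r" "locally_lipschitz_on (coord_space B) r"
    and h: "GDERIV h x :> c"
    and min: "\<And>w. w \<in> S \<Longrightarrow> h x + r x \<le> h w + r w"
    and v: "v \<in> mfd_tangent_cone M S V \<phi> x"
  shows "v \<in> coord_space B" "0 \<le> c \<bullet> v + r (x + v) - r x"
proof -
  let ?E = "coord_space B"
  \<comment> \<open>Decreasing for the Clarke cone, at most 1 so that
    \<open>x + t j *\<^sub>R v\<close> stays on the segment from \<open>x\<close> to
    \<open>x + v\<close>.\<close>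
  define t :: "nat \<Rightarrow> real" where "t j = inverse (real (Suc j))" for j
  have t: "\<And>j. t j > 0" "decseq t" "t \<longlonglongrightarrow> 0" "\<And>j. t j \<le> 1"
    subgoal by (simp add: t_def)
    subgoal by (simp add: t_def decseq_def field_simps)
    subgoal unfolding t_def[abs_def] by (rule LIMSEQ_inverse_real_of_nat)
    subgoal by (simp add: t_def field_simps)
    done
  obtain vs where vs: "vs \<longlonglongrightarrow> v" "\<And>j. x + t j *\<^sub>R vs j \<in> S"
    using mfd_tangent_cone_sequence[OF chart x v t(1-3)] by blast
  have xE: "x \<in> ?E" using x S by blast
  have vsE: "vs j \<in> ?E" for j
  proof -
    have "t j *\<^sub>R vs j \<in> ?E"
      using subspace_diff[OF subspace_coord_space, of "x + t j *\<^sub>R vs j" B x] vs(2) xE S by auto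
    from subspace_mul[OF subspace_coord_space this, of "inverse (t j)"]
    show ?thesis using t(1)[of j] by simp
  qed
  show vE: "v \<in> ?E"
    using closed_sequentially[OF closed_subspace[OF subspace_coord_space]] vsE vs(1) by blast
  obtain u C where u: "u > 0" and C: "C-lipschitz_on (cball x u \<inter> ?E) r"
    using r(2) xE unfolding locally_lipschitz_on_def by blast
  have near: "\<forall>\<^sub>F j in sequentially. x + t j *\<^sub>R ws j \<in> cball x u" if "ws \<longlonglongrightarrow> w" for ws w
  proof -
    have "(\<lambda>j. dist x (x + t j *\<^sub>R ws j)) \<longlonglongrightarrow> dist x (x + 0 *\<^sub>R w)"
      by (intro tendsto_intros t that)
    then show ?thesis
      using u by (auto dest!: order_tendstoD(2)[where a = u] elim!: eventually_mono)
  qed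
  have "\<forall>\<^sub>F j in sequentially.
      0 \<le> (h (x + t j *\<^sub>R vs j) - h x) /\<^sub>R t j + (r (x + v) - r x) + C * norm (vs j - v)"
    using near[OF vs(1)] near[OF tendsto_const[of v]]
  proof eventually_elim
    case (elim j)
    have xv: "x + t j *\<^sub>R v \<in> ?E" "x + t j *\<^sub>R vs j \<in> ?E" "x + v \<in> ?E"
      using vE vsE xE by (auto intro!: subspace_add subspace_mul subspace_coord_space)
    have "r (x + t j *\<^sub>R vs j) - r (x + t j *\<^sub>R v) \<le> C * dist (x + t j *\<^sub>R vs j) (x + t j *\<^sub>R v)"
      using lipschitz_onD[OF C, of "x + t j *\<^sub>R vs j" "x + t j *\<^sub>R v"] elim xv
      by (auto simp: dist_real_def)
    also have "dist (x + t j *\<^sub>R vs j) (x + t j *\<^sub>R v) = t j * norm (vs j - v)"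
      using t(1)[of j] by (simp add: dist_norm flip: scaleR_diff_right)
    finally have 1: "r (x + t j *\<^sub>R vs j) - r (x + t j *\<^sub>R v) \<le> C * (t j * norm (vs j - v))" .
    have "r ((1 - t j) *\<^sub>R x + t j *\<^sub>R (x + v)) \<le> (1 - t j) * r x + t j * r (x + v)"
      using r(1) t(1)[of j] t(4)[of j] xE xv by (intro convex_onD) auto
    then have 2: "r (x + t j *\<^sub>R v) \<le> (1 - t j) * r x + t j * r (x + v)"
      by (simp add: algebra_simps)
    have "0 \<le> (h (x + t j *\<^sub>R vs j) - h x) + (r (x + t j *\<^sub>R vs j) - r x)"
      using min[OF vs(2)[of j]] by simp
    also have "\<dots> \<le> (h (x + t j *\<^sub>R vs j) - h x) + (t j * (r (x + v) - r x) + C * (t j * norm (vs j - v)))"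
      using 1 2 by (simp add: algebra_simps)
    also have "\<dots> = t j * ((h (x + t j *\<^sub>R vs j) - h x) /\<^sub>R t j + (r (x + v) - r x) + C * norm (vs j - v))"
      using t(1)[of j] by (simp add: field_simps)
    finally show ?case using t(1)[of j] by (simp add: zero_le_mult_iff)
  qed
  moreover have "(\<lambda>j. (h (x + t j *\<^sub>R vs j) - h x) /\<^sub>R t j + (r (x + v) - r x) + C * norm (vs j - v))
      \<longlonglongrightarrow> v \<bullet> c + (r (x + v) - r x) + C * norm (v - v)"
    by (intro tendsto_intros vs(1) has_derivative_sequential_direction[OF h[unfolded gderiv_def] t(1,3)])
  ultimately have "0 \<le> v \<bullet> c + (r (x + v) - r x) + C * norm (v - v)"
    by (intro tendsto_lowerbound) auto
  then show "0 \<le> c \<bullet> v + r (x + v) - r x" by (simp add: inner_commute)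
qed

text \<open>
  Separating the strict epigraph of \<open>v \<mapsto> r (x + v) - r x + c \<bullet> v\<close> from
  \<open>T \<times> {..0}\<close> yields the subgradient without a minimax theorem.
\<close>

lemma subgradient_of_cone_minimizer:
  fixes r :: "real^'c \<Rightarrow> real"
  assumes r: "convex_on (coord_space B) r" and x: "x \<in> coord_space B"
    and T: "T \<subseteq> coord_space B" "0 \<in> T" "\<And>u v. u \<in> T \<Longrightarrow> v \<in> T \<Longrightarrow> u + v \<in> T"
      "\<And>s v. s \<ge> 0 \<Longrightarrow> v \<in> T \<Longrightarrow> s *\<^sub>R v \<in> T"
    and min: "\<And>v. v \<in> T \<Longrightarrow> 0 \<le> c \<bullet> v + r (x + v) - r x"
  obtains g where "g \<in> subdiff (coord_space B) r x" "\<And>v. v \<in> T \<Longrightarrow> 0 \<le> (c + g) \<bullet> v"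
proof -
  let ?E = "coord_space B" and ?P = "coord_proj B"
  \<comment> \<open>The projection extends the function from the block to the whole space, where the
    separation takes place. The subgradient obtained there is shown to lie in the block
    afterwards.\<close>
  define F where "F v = r (x + ?P v) - r x + c \<bullet> v" for v
  define A where "A = {(v, s). F v < s}"
  have xP: "x + ?P v \<in> ?E" for v
    by (intro subspace_add subspace_coord_space x coord_proj_in)
  have F_convex: "F (u *\<^sub>R v + (1 - u) *\<^sub>R w) \<le> u * F v + (1 - u) * F w"
    if "0 \<le> u" "u \<le> 1" for u v w
  proof -
    have "x + ?P (u *\<^sub>R v + (1 - u) *\<^sub>R w) = (1 - u) *\<^sub>R (x + ?P w) + u *\<^sub>R (x + ?P v)"
      by (simp only: coord_proj_add coord_proj_scaleR) (simp add: algebra_simps)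
    then have "r (x + ?P (u *\<^sub>R v + (1 - u) *\<^sub>R w)) \<le> (1 - u) * r (x + ?P w) + u * r (x + ?P v)"
      using convex_onD[OF r, of u] that xP by simp
    then show ?thesis by (simp add: F_def algebra_simps)
  qed
  have "convex A"
  proof (rule convexI)
    fix a b :: "(real^'c) \<times> real" and u w :: real
    assume ab: "a \<in> A" "b \<in> A" and uw: "0 \<le> u" "0 \<le> w" "u + w = 1"
    obtain v s v' s' where [simp]: "a = (v, s)" "b = (v', s')" by fastforce
    have w: "w = 1 - u" using uw by simp
    have "F (u *\<^sub>R v + w *\<^sub>R v') \<le> u * F v + w * F v'" using F_convex[of u v v'] uw w by simp
    also have "\<dots> < u * s + w * s'"
    proof (cases "u = 0")
      case True
      then show ?thesis using ab uw by (simp add: A_def)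
    next
      case False
      then have "u * F v < u * s" using ab uw by (simp add: A_def)
      moreover have "w * F v' \<le> w * s'" using ab uw by (intro mult_left_mono) (auto simp: A_def)
      ultimately show ?thesis by simp
    qed
    finally show "u *\<^sub>R a + w *\<^sub>R b \<in> A" by (simp add: A_def)
  qed
  moreover have "convex (T \<times> {..0::real})"
    by (intro convex_Times convex_real_interval) (auto intro!: convexI T)
  moreover have "(T \<times> {..0}) \<inter> A = {}"
  proof -
    have "0 \<le> F v" if "v \<in> T" for v
      using min[OF that] that T(1) by (auto simp: F_def coord_proj_id subset_iff)
    then show ?thesis by (force simp: A_def)
  qed
  moreover have "(0, F 0 + 1) \<in> A" by (simp add: A_def)
  ultimately obtain z b where z: "z \<noteq> 0" "\<And>a. a \<in> T \<times> {..0} \<Longrightarrow> z \<bullet> a \<le> b"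
      "\<And>a. a \<in> A \<Longrightarrow> b \<le> z \<bullet> a"
    using separating_hyperplane_sets[of "T \<times> {..0}" A] T(2) by (metis SigmaI atMost_iff empty_iff order_refl)
  obtain p q where [simp]: "z = (p, q)" by fastforce
  have F0: "F 0 = 0" using coord_proj_id[of 0 B] by (simp add: F_def coord_space_def)
  have zT: "p \<bullet> w + q * s \<le> b" if "w \<in> T" "s \<le> 0" for w s
    using z(2)[of "(w, s)"] that by simp
  have zA: "b \<le> p \<bullet> v + q * s" if "F v < s" for v s
    using z(3)[of "(v, s)"] that by (simp add: A_def)
  have b0: "0 \<le> b" using zT[OF T(2), of 0] by simp
  \<comment> \<open>\<open>T \<times> {..0}\<close> extends downwards without end; a negative
    \<open>q\<close> would make the functional exceed \<open>b\<close> at height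
    \<open>(b + 1) / q\<close>.\<close>
  have q0: "0 \<le> q"
  proof (rule ccontr)
    assume "\<not> 0 \<le> q"
    then have "(b + 1) / q \<le> 0" using b0 by (intro divide_nonneg_nonpos) auto
    from zT[OF T(2) this] show False using \<open>\<not> 0 \<le> q\<close> by simp
  qed
  \<comment> \<open>\<open>F\<close> is finite everywhere, so a vertical hyperplane cannot bound its
    epigraph: the point over \<open>- p\<close> refutes it.\<close>
  have "q \<noteq> 0"
  proof
    assume q: "q = 0"
    have "b \<le> p \<bullet> (- p) + q * (F (- p) + 1)" by (intro zA) simp
    then have "p \<bullet> p \<le> 0" using b0 q by simp
    then have "p = 0" by (metis inner_gt_zero_iff linorder_not_less)
    then show False using z(1) q by (simp add: zero_prod_def)
  qed
  then have q: "q > 0" using q0 by simp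
  have zF: "b \<le> p \<bullet> v + q * F v" for v
  proof (rule field_le_epsilon)
    fix e :: real assume "e > 0"
    then have "b \<le> p \<bullet> v + q * (F v + e / q)" using q by (intro zA) simp
    then show "b \<le> p \<bullet> v + q * F v + e" using q by (simp add: algebra_simps)
  qed
  have b: "b = 0" using zF[of 0] F0 b0 by simp
  \<comment> \<open>\<open>- (p /\<^sub>R q)\<close> is a subgradient of \<open>F\<close> at 0;
    removing the linear part \<open>c\<close> leaves one for \<open>r\<close> at
    \<open>x\<close>.\<close>
  define g where "g = - (p /\<^sub>R q) - c"
  have g: "g \<bullet> v \<le> r (x + ?P v) - r x" for v
  proof -
    have "0 \<le> (p \<bullet> v + q * F v) / q" using zF[of v] b q by simp
    also have "\<dots> = inverse q * (p \<bullet> v) + F v" using q by (simp add: field_simps)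
    finally show ?thesis by (simp add: g_def F_def inner_diff_left)
  qed
  have "g \<in> ?E"
    unfolding coord_space_def
  proof (intro CollectI allI impI)
    fix i assume "i \<notin> B"
    \<comment> \<open>The projection annihilates coordinates outside \<open>B\<close>, so the
      subgradient inequality loses its right-hand side there; the choice \<open>s = g $ i\<close>
      turns it into a square.\<close>
    then have "?P (s *\<^sub>R axis i 1) = 0" for s
      by (auto simp: coord_proj_def vec_eq_iff axis_def)
    then have "g \<bullet> (s *\<^sub>R axis i 1) \<le> 0" for s using g[of "s *\<^sub>R axis i 1"] by simp
    from this[of "g $ i"] show "g $ i = 0"
      by (simp add: inner_axis) (metis mult_le_0_iff nle_le)
  qed
  moreover have "r y \<ge> r x + g \<bullet> (y - x)" if "y \<in> ?E" for y
    using g[of "y - x"] coord_proj_id[OF subspace_diff[OF subspace_coord_space that x]] by simp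
  ultimately have "g \<in> subdiff ?E r x" by (simp add: subdiff_def)
  moreover have "0 \<le> (c + g) \<bullet> v" if "v \<in> T" for v
    using zT[OF that, of 0] b q by (simp add: g_def divide_simps inverse_eq_divide)
  ultimately show ?thesis using that by blast
qed

lemma orth_proj_exists:
  fixes W :: "'a::euclidean_space set"
  assumes "subspace W"
  shows "orth_proj W v \<in> W \<and> (\<forall>w\<in>W. (v - orth_proj W v) \<bullet> w = 0)"
  unfolding orth_proj_def
proof (rule theI')
  obtain y z where yz: "y \<in> span W" "\<And>w. w \<in> span W \<Longrightarrow> orthogonal z w" "v = y + z"
    using orthogonal_subspace_decomp_exists by blast
  show "\<exists>!p. p \<in> W \<and> (\<forall>w\<in>W. (v - p) \<bullet> w = 0)"
  proof (intro ex1I conjI)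
    show "y \<in> W" "\<forall>w\<in>W. (v - y) \<bullet> w = 0"
      using yz assms by (auto simp: span_eq_iff[THEN iffD2] orthogonal_def)
  next
    fix p assume p: "p \<in> W \<and> (\<forall>w\<in>W. (v - p) \<bullet> w = 0)"
    have "y - p \<in> W" using p yz(1) assms by (simp add: span_eq_iff[THEN iffD2] subspace_diff)
    then have "(v - p) \<bullet> (y - p) = 0" "(v - y) \<bullet> (y - p) = 0"
      using p yz assms by (auto simp: span_eq_iff[THEN iffD2] orthogonal_def)
    then have "(y - p) \<bullet> (y - p) = 0" by (simp add: inner_diff_left)
    then show "p = y" by simp
  qed
qed

lemma norm_orth_proj_diff_le:
  fixes W :: "'a::euclidean_space set"
  assumes "subspace W"
  shows "norm (orth_proj W u - orth_proj W v) \<le> norm (u - v)"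
proof -
  let ?d = "orth_proj W u - orth_proj W v"
  have "?d \<in> W" using orth_proj_exists[OF assms] assms by (simp add: subspace_diff)
  then have "(u - orth_proj W u) \<bullet> ?d = 0" "(v - orth_proj W v) \<bullet> ?d = 0"
    using orth_proj_exists[OF assms] by auto
  then have "?d \<bullet> ?d = (u - v) \<bullet> ?d" by (simp add: inner_diff_left)
  also have "\<dots> \<le> norm (u - v) * norm ?d" by (rule norm_cauchy_schwarz)
  finally have "norm ?d * norm ?d \<le> norm (u - v) * norm ?d" by (simp flip: power2_eq_square power2_norm_eq_inner)
  then show ?thesis by (cases "?d = 0") auto
qed

text \<open>\<open>c\<close> is the smooth gradient of the subproblem that was actually solved,
  \<open>- d\<close> the one that stationarity asks for. With the subgradient \<open>g\<close> of
  the solved problem, \<open>- c - g\<close> projects into the normal cone; using the same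
  \<open>g\<close> next to \<open>d\<close> makes it cancel, and only \<open>c + d\<close>
  remains.\<close>

lemma stationarity_setdist_le:
  fixes r h :: "real^'c \<Rightarrow> real"
  assumes M: "embedded_submanifold M" and chart: "slice_chart M D V \<phi>"
    and S: "S \<subseteq> M" "S \<subseteq> coord_space B" and x: "x \<in> S" "x \<in> V"
    and r: "convex_on (coord_space B) r" "locally_lipschitz_on (coord_space B) r"
    and h: "GDERIV h x :> c"
    and min: "\<And>w. w \<in> S \<Longrightarrow> h x + r x \<le> h w + r w"
  shows "setdist (orth_proj (tangent_space M x) ` {d - g |g. g \<in> subdiff (coord_space B) r x})
      (mfd_normal_cone M S V \<phi> x) \<le> norm (c + d)"
proof -
  let ?T = "mfd_tangent_cone M S V \<phi> x" and ?W = "tangent_space M x"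
  have W: "subspace ?W" using subspace_tangent_space[OF M] x S by blast
  have lin: "linear (frechet_derivative \<phi> (at x))"
    using slice_chart_derivative(1)[OF chart x(2)] has_derivative_linear by blast
  have T0: "0 \<in> ?T"
    using W lin by (simp add: mfd_tangent_cone_def subspace_0 linear_0 zero_mem_clarke_tangent_cone)
  have Tadd: "u + v \<in> ?T" if "u \<in> ?T" "v \<in> ?T" for u v
    using that W lin by (simp add: mfd_tangent_cone_def subspace_add linear_add clarke_tangent_cone_add)
  have Tscale: "s *\<^sub>R v \<in> ?T" if "s \<ge> 0" "v \<in> ?T" for s v
    using that W lin
    by (simp add: mfd_tangent_cone_def subspace_mul linear_cmul clarke_tangent_cone_scale)
  have xE: "x \<in> coord_space B" using x S by blast
  have TE: "?T \<subseteq> coord_space B"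
    using minimizer_linearization(1)[OF chart S(2) x r h min] by blast
  have Tmin: "\<And>v. v \<in> ?T \<Longrightarrow> 0 \<le> c \<bullet> v + r (x + v) - r x"
    using minimizer_linearization(2)[OF chart S(2) x r h min] by blast
  obtain g where g: "g \<in> subdiff (coord_space B) r x" "\<And>v. v \<in> ?T \<Longrightarrow> 0 \<le> (c + g) \<bullet> v"
    using subgradient_of_cone_minimizer[OF r(1) xE TE T0 Tadd Tscale Tmin] by blast
  let ?u = "orth_proj ?W (- c - g)"
  have "?u \<in> mfd_normal_cone M S V \<phi> x"
    unfolding mfd_normal_cone_def
  proof (intro CollectI conjI ballI)
    show "?u \<in> ?W" using orth_proj_exists[OF W] by blast
    fix v assume v: "v \<in> ?T"
    then have "v \<in> ?W" by (simp add: mfd_tangent_cone_def)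
    then have "((- c - g) - ?u) \<bullet> v = 0" using orth_proj_exists[OF W] by blast
    then show "?u \<bullet> v \<le> 0" using g(2)[OF v] by (simp add: inner_diff_left inner_add_left)
  qed
  then have "setdist (orth_proj ?W ` {d - g |g. g \<in> subdiff (coord_space B) r x})
      (mfd_normal_cone M S V \<phi> x) \<le> dist (orth_proj ?W (d - g)) ?u"
    using g(1) by (intro setdist_le_dist) auto
  also have "\<dots> \<le> norm ((d - g) - (- c - g))"
    unfolding dist_norm by (rule norm_orth_proj_diff_le[OF W])
  finally show ?thesis by (simp add: add.commute)
qed

section \<open>Singular values on a block\<close>

lemma symmetric_matrix_inner:
  fixes H :: "real^'n^'n"
  assumes "transpose H = H"
  shows "(H *v a) \<bullet> b = a \<bullet> (H *v b)"
  by (metis assms dot_lmul_matrix transpose_matrix_vector)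

text \<open>If \<open>H *v (H *v v)\<close> is the multiple of \<open>v\<close> by the square of
  \<open>s\<close>, then \<open>u = H *v v - s *\<^sub>R v\<close> satisfies
  \<open>H *v u = - (s *\<^sub>R u)\<close>, which definiteness allows only for
  \<open>u = 0\<close>.\<close>

lemma singular_value_eigenvector:
  assumes H: "pos_def_on E H" and E: "subspace E" "\<And>v. H *v v \<in> E"
    and s: "s \<in> singular_values_on E H"
  obtains v where "v \<in> E" "v \<noteq> 0" "H *v v = s *\<^sub>R v"
proof -
  have sym: "transpose H = H" using H by (simp add: pos_def_on_def)
  obtain \<mu> v where v: "s = sqrt \<mu>" "v \<in> E" "v \<noteq> 0" "H *v (H *v v) = \<mu> *\<^sub>R v"
    using s sym by (auto simp: singular_values_on_def simp flip: matrix_vector_mul_assoc)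
  \<comment> \<open>The root of a negative number is negative here and does not square back, so the
    sign of \<mu> must be settled before \<open>s * s = \<mu>\<close>.\<close>
  have "\<mu> * (v \<bullet> v) = (H *v v) \<bullet> (H *v v)"
    using v(4) symmetric_matrix_inner[OF sym, of v "H *v v"] by simp
  then have "0 \<le> \<mu> * (v \<bullet> v)" by simp
  then have "0 \<le> \<mu>" using v(3) by (simp add: zero_le_mult_iff) (metis inner_gt_zero_iff not_less)
  then have s0: "0 \<le> s" "s * s = \<mu>" using v(1) by auto
  define u where "u = H *v v - s *\<^sub>R v"
  have "H *v u = - (s *\<^sub>R u)"
    using v(4) s0 by (simp add: u_def matrix_vector_mult_diff_distrib matrix_vector_mult_scaleR scaleR_right_diff_distrib)
  then have "u \<bullet> (H *v u) \<le> 0" using s0 by simp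
  moreover have "u \<in> E" unfolding u_def by (intro subspace_diff subspace_mul E v)
  ultimately have "u = 0" using H by (force simp: pos_def_on_def)
  then show ?thesis using v that by (simp add: u_def)
qed

text \<open>\<open>sigma_min_on\<close> is a \<open>Min\<close>, which is informative on finite
  sets. Eigenvectors for different eigenvalues are orthogonal, hence independent, hence finite in
  number.\<close>

lemma finite_singular_values_on:
  assumes H: "pos_def_on E H" and E: "subspace E" "\<And>v. H *v v \<in> E"
  shows "finite (singular_values_on E H)"
proof -
  let ?S = "singular_values_on E H"
  have sym: "transpose H = H" using H by (simp add: pos_def_on_def)
  have "\<forall>s\<in>?S. \<exists>v. v \<noteq> 0 \<and> H *v v = s *\<^sub>R v"
    using singular_value_eigenvector[OF H E] by metis
  then obtain ev where ev: "\<And>s. s \<in> ?S \<Longrightarrow> ev s \<noteq> 0" "\<And>s. s \<in> ?S \<Longrightarrow> H *v ev s = s *\<^sub>R ev s"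
    by metis
  have inj: "inj_on ev ?S"
  proof (rule inj_onI)
    fix s t assume st: "s \<in> ?S" "t \<in> ?S" "ev s = ev t"
    then have "s *\<^sub>R ev s = t *\<^sub>R ev s" using ev(2) by metis
    then show "s = t" using ev(1) st(1) by simp
  qed
  have "pairwise orthogonal (ev ` ?S)"
    unfolding pairwise_image
  proof (rule pairwiseI, rule impI)
    fix s t assume st: "s \<in> ?S" "t \<in> ?S" "s \<noteq> t"
    have "(H *v ev s) \<bullet> ev t = ev s \<bullet> (H *v ev t)" by (rule symmetric_matrix_inner[OF sym])
    then have "s * (ev s \<bullet> ev t) = t * (ev s \<bullet> ev t)" using ev(2) st by simp
    then show "orthogonal (ev s) (ev t)" using st(3) by (simp add: orthogonal_def)
  qed
  moreover have "0 \<notin> ev ` ?S" using ev(1) by force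
  ultimately have "finite (ev ` ?S)"
    using pairwise_orthogonal_independent independent_imp_finite by blast
  then show ?thesis using finite_imageD inj by blast
qed

text \<open>The Rayleigh quotient attains its minimum on the compact unit sphere of
  \<open>E\<close>; a minimizer that were no eigenvector could be improved by moving against
  \<open>z = H *v u - s *\<^sub>R u\<close>.\<close>

lemma least_singular_value:
  assumes H: "pos_def_on E H" and E: "subspace E" "\<And>v. H *v v \<in> E" and nz: "w \<in> E" "w \<noteq> 0"
  obtains s where "s \<in> singular_values_on E H" "\<And>v. v \<in> E \<Longrightarrow> s * (norm v)\<^sup>2 \<le> v \<bullet> (H *v v)"
proof -
  have sym: "transpose H = H" using H by (simp add: pos_def_on_def)
  let ?K = "sphere 0 1 \<inter> E"
  have "compact ?K" by (intro compact_Int_closed compact_sphere closed_subspace E)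
  moreover have "w /\<^sub>R norm w \<in> ?K" using nz by (simp add: subspace_mul E)
  moreover have "continuous_on ?K (\<lambda>v. v \<bullet> (H *v v))"
    by (intro continuous_intros matrix_vector_mult_linear_continuous_on)
  ultimately obtain u where u: "u \<in> ?K" "\<And>v. v \<in> ?K \<Longrightarrow> u \<bullet> (H *v u) \<le> v \<bullet> (H *v v)"
    using continuous_attains_inf[of ?K "\<lambda>v. v \<bullet> (H *v v)"] by blast
  define s where "s = u \<bullet> (H *v u)"
  have le: "s * (norm v)\<^sup>2 \<le> v \<bullet> (H *v v)" if "v \<in> E" for v
  proof (cases "v = 0")
    case False
    then have "v /\<^sub>R norm v \<in> ?K" using that by (simp add: subspace_mul E)
    from u(2)[OF this] have "s \<le> (v \<bullet> (H *v v)) / (norm v)\<^sup>2"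
      by (simp add: s_def matrix_vector_mult_scaleR power2_eq_square divide_inverse mult_ac)
    then show ?thesis using False by (simp add: field_simps)
  qed simp
  have uE: "u \<in> E" and u1: "u \<bullet> u = 1" using u(1) by (auto simp: norm_eq_1)
  have "u \<noteq> 0" using u1 by auto
  have s0: "0 < s" using H uE \<open>u \<noteq> 0\<close> by (simp add: s_def pos_def_on_def)
  define z where "z = H *v u - s *\<^sub>R u"
  define q where "q = z \<bullet> (H *v z) - s * (z \<bullet> z)"
  have zE: "z \<in> E" unfolding z_def by (intro subspace_diff subspace_mul E uE)
  have "z = 0"
  proof (rule ccontr)
    assume "z \<noteq> 0"
    define d where "d = z \<bullet> z"
    have d: "d > 0" using \<open>z \<noteq> 0\<close> by (simp add: d_def)
    have quad: "0 \<le> t * t * q - 2 * t * d" for t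
    proof -
      have "u - t *\<^sub>R z \<in> E" by (intro subspace_diff subspace_mul E uE zE)
      from le[OF this] have "s * ((u - t *\<^sub>R z) \<bullet> (u - t *\<^sub>R z)) \<le> (u - t *\<^sub>R z) \<bullet> (H *v (u - t *\<^sub>R z))"
        by (simp add: power2_norm_eq_inner)
      also have "\<dots> = s - 2 * t * ((H *v u) \<bullet> z) + t * t * (z \<bullet> (H *v z))"
        using symmetric_matrix_inner[OF sym, of u z]
        by (simp add: s_def matrix_vector_mult_diff_distrib matrix_vector_mult_scaleR inner_diff_left
            inner_diff_right inner_commute algebra_simps)
      finally have "s * ((u - t *\<^sub>R z) \<bullet> (u - t *\<^sub>R z)) \<le> s - 2 * t * ((H *v u) \<bullet> z) + t * t * (z \<bullet> (H *v z))" .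
      moreover have "(H *v u) \<bullet> z = d + s * (u \<bullet> z)"
        by (simp add: d_def z_def inner_diff_left inner_diff_right inner_commute algebra_simps)
      ultimately show ?thesis
        using u1 by (simp add: q_def d_def inner_diff_left inner_diff_right inner_commute algebra_simps)
    qed
    \<comment> \<open>Makes \<open>t * q\<close> at most \<open>d\<close>, while minimality demands
      \<open>2 * d \<le> t * q\<close>.\<close>
    define t where "t = d / (\<bar>q\<bar> + 1)"
    have t: "t > 0" "t * (\<bar>q\<bar> + 1) = d" using d by (simp_all add: t_def add_nonneg_pos add_nonneg_eq_0_iff)
    have "t * 0 \<le> t * (t * q - 2 * d)" using quad[of t] by (simp add: algebra_simps)
    then have "0 \<le> t * q - 2 * d" using t(1) by (rule mult_left_le_imp_le)
    then have "2 * d \<le> t * q" by simp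
    also have "\<dots> \<le> t * (\<bar>q\<bar> + 1)" using t by (intro mult_left_mono) auto
    also note t(2)
    finally show False using d by simp
  qed
  then have Hu: "H *v u = s *\<^sub>R u" by (simp add: z_def)
  have "(transpose H ** H) *v u = s\<^sup>2 *\<^sub>R u"
    using sym Hu
    by (simp add: matrix_vector_mult_scaleR power2_eq_square flip: matrix_vector_mul_assoc)
  then have "s \<in> singular_values_on E H"
    using uE \<open>u \<noteq> 0\<close> s0 unfolding singular_values_on_def
    by (intro CollectI exI[of _ "s\<^sup>2"]) auto
  then show ?thesis using le that by blast
qed

lemma sigma_min_on_le_rayleigh:
  assumes H: "pos_def_on E H" and E: "subspace E" "\<And>v. H *v v \<in> E" and v: "v \<in> E"
  shows "sigma_min_on E H * (norm v)\<^sup>2 \<le> v \<bullet> (H *v v)"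
proof (cases "v = 0")
  case False
  obtain s where s: "s \<in> singular_values_on E H" "s * (norm v)\<^sup>2 \<le> v \<bullet> (H *v v)"
    using least_singular_value[OF H E v False] v by blast
  have "sigma_min_on E H \<le> s"
    unfolding sigma_min_on_def by (intro Min_le finite_singular_values_on H E s(1))
  then have "sigma_min_on E H * (norm v)\<^sup>2 \<le> s * (norm v)\<^sup>2" by (intro mult_right_mono) auto
  then show ?thesis using s(2) by simp
qed simp

text \<open>The minimum is attained, and definiteness of the shifted matrix is tested on its
  eigenvector. The vector \<open>w\<close> ensures that there is a singular value at all.\<close>

lemma less_sigma_min_on:
  assumes H: "pos_def_on E H" and E: "subspace E" "\<And>v. H *v v \<in> E" and nz: "w \<in> E" "w \<noteq> 0"
    and c: "pos_def_on E (H - mat c)"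
  shows "c < sigma_min_on E H"
proof -
  have "singular_values_on E H \<noteq> {}" using least_singular_value[OF H E nz] by blast
  then have "sigma_min_on E H \<in> singular_values_on E H"
    unfolding sigma_min_on_def by (intro Min_in finite_singular_values_on H E)
  then obtain v where v: "v \<in> E" "v \<noteq> 0" "H *v v = sigma_min_on E H *\<^sub>R v"
    using singular_value_eigenvector[OF H E] by blast
  have "mat c *v v = c *\<^sub>R v"
    by (simp add: vec_eq_iff matrix_vector_mult_def mat_def mult_delta_left)
  then have "0 < (sigma_min_on E H - c) * (v \<bullet> v)"
    using c v by (auto simp: pos_def_on_def matrix_vector_mult_diff_rdistrib inner_diff_right algebra_simps)
  then show ?thesis by (simp add: zero_less_mult_iff) (metis inner_ge_zero not_less)
qed

section \<open>Norms, gradients and sequences\<close>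

lemma mat_norm2_bound: "norm (A *v v) \<le> mat_norm2 A * norm v" for A :: "real^'n^'k"
  by (rule onorm) (simp add: linear_linear)

lemma mat_norm2_nonneg: "0 \<le> mat_norm2 A" for A :: "real^'n^'k"
  by (rule onorm_pos_le) (simp add: linear_linear)

lemma mat_norm2_transpose_bound: "norm (transpose A *v v) \<le> mat_norm2 A * norm v"
  for A :: "real^'n^'k"
proof -
  let ?w = "transpose A *v v"
  have "?w \<bullet> ?w = v \<bullet> (A *v ?w)" by (simp add: dot_lmul_matrix)
  also have "\<dots> \<le> norm v * norm (A *v ?w)" by (rule norm_cauchy_schwarz)
  also have "\<dots> \<le> norm v * (mat_norm2 A * norm ?w)" by (intro mult_left_mono mat_norm2_bound) simp
  finally have "norm ?w * norm ?w \<le> (mat_norm2 A * norm v) * norm ?w"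
    by (simp add: algebra_simps flip: power2_eq_square power2_norm_eq_inner)
  then show ?thesis
    using mat_norm2_nonneg[of A] by (cases "norm ?w = 0") auto
qed

lemma grad_eqI: "GDERIV f x :> D \<Longrightarrow> grad f x = D"
  unfolding grad_def
proof (rule the_equality)
  fix D' assume "GDERIV f x :> D" "GDERIV f x :> D'"
  then have "(\<lambda>h. h \<bullet> D) = (\<lambda>h. h \<bullet> D')"
    unfolding gderiv_def by (rule has_derivative_unique)
  then show "D' = D" by (metis vector_eq_ldot inner_commute)
qed

lemma lipschitz_gradient_descent:
  fixes f :: "'a::real_inner \<Rightarrow> real"
  assumes f: "\<And>z. GDERIV f z :> g z" and L: "L-lipschitz_on UNIV g"
  shows "f y \<le> f x + g x \<bullet> (y - x) + L / 2 * (norm (y - x))\<^sup>2"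
proof -
  define d where "d = y - x"
  \<comment> \<open>The function along the segment minus its quadratic model; the Lipschitz bound
    makes the derivative nonpositive on the unit interval.\<close>
  define p where "p t = f (x + t *\<^sub>R d) - t * (g x \<bullet> d) - L / 2 * t\<^sup>2 * (norm d)\<^sup>2" for t :: real
  have "p 1 \<le> p 0"
  proof (rule DERIV_nonpos_imp_nonincreasing[of 0 1 p])
    fix t :: real assume t: "0 \<le> t" "t \<le> 1"
    have "((\<lambda>t. x + t *\<^sub>R d) has_derivative (\<lambda>s. s *\<^sub>R d)) (at t)"
      by (auto intro!: derivative_eq_intros)
    from has_derivative_compose[OF this f[unfolded gderiv_def]]
    have fd: "((\<lambda>t. f (x + t *\<^sub>R d)) has_real_derivative (g (x + t *\<^sub>R d) \<bullet> d)) (at t)"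
      by (simp add: has_field_derivative_def inner_commute mult_commute_abs)
    have "(p has_real_derivative (g (x + t *\<^sub>R d) \<bullet> d - g x \<bullet> d - L * t * (norm d)\<^sup>2)) (at t)"
      unfolding p_def by (auto intro!: derivative_eq_intros fd)
    moreover have "(g (x + t *\<^sub>R d) - g x) \<bullet> d \<le> L * t * (norm d)\<^sup>2"
    proof -
      have "(g (x + t *\<^sub>R d) - g x) \<bullet> d \<le> norm (g (x + t *\<^sub>R d) - g x) * norm d"
        by (rule norm_cauchy_schwarz)
      also have "\<dots> \<le> (L * norm (t *\<^sub>R d)) * norm d"
        using lipschitz_onD[OF L, of "x + t *\<^sub>R d" x]
        by (intro mult_right_mono) (auto simp: dist_norm)
      also have "\<dots> = L * t * (norm d)\<^sup>2" using t by (simp add: power2_eq_square)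
      finally show ?thesis .
    qed
    ultimately show "\<exists>y. (p has_real_derivative y) (at t) \<and> y \<le> 0"
      by (force simp: inner_diff_left)
  qed simp
  then show ?thesis by (simp add: p_def d_def)
qed

text \<open>Origin of the factor 3 in \<kappa>1, in \<tau> and in the potential.\<close>

lemma norm_add3_squared_le: "(norm (a + b + c))\<^sup>2 \<le> 3 * ((norm a)\<^sup>2 + (norm b)\<^sup>2 + (norm c)\<^sup>2)"
  for a b c :: "'a::real_inner"
proof -
  have "0 \<le> (norm (a - b))\<^sup>2 + (norm (b - c))\<^sup>2 + (norm (a - c))\<^sup>2" by simp
  then show ?thesis
    by (simp add: power2_norm_eq_inner inner_diff_left inner_diff_right inner_add_left inner_add_right
        inner_commute algebra_simps)
qed

text \<open>
  \<open>a k - c\<close> dominates the increments of a nonnegative sequence, so once \<open>a\<close> falls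
  below \<open>c\<close> it would drive that sequence to \<open>-\<infinity>\<close>.
\<close>

lemma decreasing_ge_of_telescoping:
  fixes a s :: "nat \<Rightarrow> real"
  assumes "\<And>k. a (Suc k) \<le> a k" "\<And>k. s (Suc k) - s k \<le> a (Suc k) - c" "\<And>k. 0 \<le> s k"
  shows "c \<le> a m"
proof (rule ccontr)
  assume m: "\<not> c \<le> a m"
  have mono: "a (m + n) \<le> a m" for n
    by (induction n) (use assms(1) order_trans in auto)
  have "s (m + n) \<le> s m - n * (c - a m)" for n
  proof (induction n)
    case (Suc n)
    have "s (m + Suc n) \<le> s (m + n) + (a m - c)"
      using assms(2)[of "m + n"] mono[of "Suc n"] by simp
    then show ?case using Suc by (simp add: algebra_simps)
  qed simp
  moreover obtain n :: nat where "s m < n * (c - a m)"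
    using reals_Archimedean3[of "c - a m"] m by auto
  ultimately show False using assms(3)[of "m + n"] by (metis diff_less_0_iff_less linorder_not_less order_trans)
qed

text \<open>\<open>R\<close> collects the part of the residual that is frozen while one block
  varies. With \<open>A\<close> a block matrix this serves the manifold blocks, with
  \<open>A = mat 1\<close> the last block.\<close>

lemma GDERIV_penalty:
  fixes A :: "real^'n^'k"
  shows "GDERIV (\<lambda>w. \<beta> / 2 * (norm (R + A *v w))\<^sup>2 - (R + A *v w) \<bullet> l) w
    :> transpose A *v (\<beta> *\<^sub>R (R + A *v w) - l)"
proof -
  have "((\<lambda>w. R + A *v w) has_derivative (\<lambda>d. 0 + A *v d)) (at w)"
    by (intro has_derivative_add has_derivative_const
        bounded_linear.has_derivative[OF matrix_vector_mul_bounded_linear] has_derivative_ident)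
  then have d: "((\<lambda>w. R + A *v w) has_derivative (\<lambda>d. A *v d)) (at w)" by simp
  have "((\<lambda>w. \<beta> / 2 * ((R + A *v w) \<bullet> (R + A *v w)) - (R + A *v w) \<bullet> l) has_derivative
      (\<lambda>d. \<beta> / 2 * ((R + A *v w) \<bullet> (A *v d) + (A *v d) \<bullet> (R + A *v w)) - (A *v d) \<bullet> l)) (at w)"
    by (intro has_derivative_diff has_derivative_mult_right has_derivative_inner
        has_derivative_inner_left d)
  moreover have "\<beta> / 2 * ((R + A *v w) \<bullet> (A *v d) + (A *v d) \<bullet> (R + A *v w)) - (A *v d) \<bullet> l =
      d \<bullet> (transpose A *v (\<beta> *\<^sub>R (R + A *v w) - l))" for d
  proof -
    have "d \<bullet> (transpose A *v (\<beta> *\<^sub>R (R + A *v w) - l)) = (A *v d) \<bullet> (\<beta> *\<^sub>R (R + A *v w) - l)"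
      by (metis dot_lmul_matrix inner_commute transpose_matrix_vector)
    then show ?thesis by (simp add: inner_diff_right inner_commute)
  qed
  ultimately show ?thesis by (simp add: gderiv_def power2_norm_eq_inner)
qed

lemma GDERIV_quadratic_form:
  fixes H :: "real^'n^'n"
  assumes "transpose H = H"
  shows "GDERIV (\<lambda>w. 1 / 2 * ((w - a) \<bullet> (H *v (w - a)))) w :> H *v (w - a)"
proof -
  have d: "((\<lambda>w. w - a) has_derivative (\<lambda>d. d)) (at w)"
    by (auto intro!: derivative_eq_intros)
  have "((\<lambda>w. 1 / 2 * ((w - a) \<bullet> (H *v (w - a)))) has_derivative
      (\<lambda>d. 1 / 2 * ((w - a) \<bullet> (H *v d) + d \<bullet> (H *v (w - a))))) (at w)"
    by (intro has_derivative_mult_right has_derivative_inner d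
        bounded_linear.has_derivative[OF matrix_vector_mul_bounded_linear])
  moreover have "(w - a) \<bullet> (H *v d) = d \<bullet> (H *v (w - a))" for d
    using symmetric_matrix_inner[OF assms, of "w - a" d] by (simp add: inner_commute)
  ultimately show ?thesis by (simp add: gderiv_def)
qed

section \<open>Block coordinates\<close>

lemma norm_proj_le: "norm (fst z) \<le> norm z" "norm (snd z) \<le> norm z"
  using norm_fst_le[of "fst z" "snd z"] norm_snd_le[of "snd z" "fst z"] by simp_all

lemma linear_block: "linear (block P i)"
  by (rule linearI) (simp_all add: block_def coord_proj_add coord_proj_scaleR)

lemmas block_diff = linear_diff[OF linear_block]

lemma block_in_space: "block P i v \<in> block_space P i"
  by (simp add: block_def block_space_def coord_proj_in)

lemma block_id: "v \<in> block_space P i \<Longrightarrow> block P i v = v"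
  by (simp add: block_def block_space_def coord_proj_id)

lemma block_nth: "block P i v $ c = (if block_of P c = i then v $ c else 0)"
  by (simp add: block_def coord_proj_def)

lemma block_inner: "block P i u \<bullet> v = u \<bullet> block P i v"
  by (simp add: inner_vec_def block_nth if_distrib if_distribR cong: if_cong)

lemma norm_block_le: "norm (block P i v) \<le> norm v"
  by (rule norm_le_componentwise_cart) (simp add: block_nth)

lemma norm_squared_blocks:
  assumes "range (block_of P) = B"
  shows "(\<Sum>i\<in>B. (norm (block P i v))\<^sup>2) = (norm v)\<^sup>2"
proof -
  have fin: "finite B" unfolding assms[symmetric] by simp
  have "(norm (block P i v))\<^sup>2 = (\<Sum>c\<in>UNIV. if i = block_of P c then v $ c * v $ c else 0)" for i
    unfolding power2_norm_eq_inner inner_vec_def by (auto intro!: sum.cong simp: block_nth)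
  then have "(\<Sum>i\<in>B. (norm (block P i v))\<^sup>2) =
      (\<Sum>c\<in>UNIV. \<Sum>i\<in>B. if i = block_of P c then v $ c * v $ c else 0)"
    by (simp add: sum.swap[of _ UNIV])
  also have "\<dots> = (\<Sum>c\<in>UNIV. v $ c * v $ c)"
    using fin assms by (intro sum.cong refl) auto
  finally show ?thesis by (simp add: power2_norm_eq_inner inner_vec_def)
qed

lemma block_sweep:
  "block P j (sweep P i u w v) = block P j (if j < i then u else if j = i then w else v)"
  by (simp add: vec_eq_iff block_nth sweep_def)

lemma sweep_block: "sweep P i u (block P i w) v = sweep P i u w v"
  by (simp add: vec_eq_iff block_nth sweep_def)

lemma sweep_eq_add_block: "sweep P i u w v = sweep P i u 0 v + block P i w"
  by (simp add: vec_eq_iff block_nth sweep_def)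

text \<open>The state before the update of block \<open>i + 1\<close> is the state after that of
  block \<open>i\<close>; this lets the block decreases telescope.\<close>

lemma sweep_Suc: "sweep P (Suc i) u v v = sweep P i u u v"
  by (simp add: vec_eq_iff sweep_def less_Suc_eq)

lemma sweep_ends:
  assumes "range (block_of P) = {1..n}"
  shows "sweep P 0 u u v = v" "sweep P n u u v = u"
proof -
  have "block_of P c \<in> {1..n}" for c using assms by blast
  then have b: "block_of P c \<noteq> 0" "block_of P c \<le> n" for c by (simp_all add: Suc_le_eq)
  show "sweep P 0 u u v = v" by (simp add: vec_eq_iff sweep_def b)
  show "sweep P n u u v = u" by (auto simp: vec_eq_iff sweep_def b le_neq_implies_less)
qed

lemma norm_sweep_diff_le: "norm (sweep P i u u v - u) \<le> norm (v - u)"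
  by (rule norm_le_componentwise_cart) (simp add: sweep_def)

lemma cmat_mult_block:
  assumes "\<forall>j c. c \<notin> coords P i \<longrightarrow> cmat P i $ j $ c = 0"
  shows "cmat P i *v block P k v = (if k = i then cmat P i *v v else 0)"
  using assms
  by (auto simp: vec_eq_iff matrix_vector_mult_def block_nth intro!: sum.cong sum.neutral)

section \<open>Runs of the algorithm\<close>

locale algorithm_run =
  fixes P :: "('c::finite, 'm::finite) problem"
    and L \<beta> \<gamma> :: real and H :: "nat \<Rightarrow> real^'c^'c"
    and x :: "nat \<Rightarrow> real^'c" and y lam :: "nat \<Rightarrow> real^'m"
  assumes standing: "standing_assumptions P L"
    and algorithm: "generated_by_algorithm P \<beta> \<gamma> H x y lam"
begin

section \<open>Data of a run and derivatives of its subproblems\<close>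

abbreviation "blocks \<equiv> {1..nblocks P - 1}"
abbreviation "G \<equiv> grad (obj P)"

lemma nblocks: "nblocks P \<ge> 2" and range_block_of: "range (block_of P) = blocks"
  and L_pos: "L > 0" and beta_pos: "\<beta> > 0" and gamma_pos: "\<gamma> > 0"
  using standing algorithm by (auto simp: standing_assumptions_def generated_by_algorithm_def)

lemma block_data:
  assumes "i \<in> blocks"
  shows "convex_on (block_space P i) (reg P i)" "locally_lipschitz_on (block_space P i) (reg P i)"
    "mfd P i \<subseteq> block_space P i" "embedded_submanifold (mfd P i)"
    "\<forall>j c. c \<notin> coords P i \<longrightarrow> cmat P i $ j $ c = 0"
    "bdd_below (reg P i ` (mfd P i \<inter> cvx P i))"
  using standing assms by (simp_all add: standing_assumptions_def)

lemma GDERIV_obj: "GDERIV (obj P) z :> G z"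
  using standing grad_eqI unfolding standing_assumptions_def by metis

lemma grad_lipschitz: "L-lipschitz_on UNIV G"
  using standing unfolding standing_assumptions_def by blast

lemma norm_grad_diff: "norm (G z - G w) \<le> L * norm (z - w)"
  using lipschitz_onD[OF grad_lipschitz, of z w] by (simp add: dist_norm)

lemma H_block:
  assumes "i \<in> blocks"
  shows "pos_def_on (block_space P i) (H i)" "H i *v v \<in> block_space P i"
proof -
  have z: "\<forall>c d. c \<notin> coords P i \<or> d \<notin> coords P i \<longrightarrow> H i $ c $ d = 0"
    and p: "pos_def_on (block_space P i) (H i)"
    using algorithm assms unfolding generated_by_algorithm_def by blast+
  show "pos_def_on (block_space P i) (H i)" by (rule p)
  show "H i *v v \<in> block_space P i"
    using z by (simp add: block_space_def coord_space_def matrix_vector_mult_def)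
qed

lemma block_step_minimizer:
  assumes "i \<in> blocks"
  shows "is_arg_min
      (\<lambda>w. aug_lag P \<beta> (sweep P i (x (Suc k)) w (x k)) (y k) (lam k)
        + 1 / 2 * ((w - block P i (x k)) \<bullet> (H i *v (w - block P i (x k)))))
      (\<lambda>w. w \<in> mfd P i \<inter> cvx P i) (block P i (x (Suc k)))"
  using algorithm assms unfolding generated_by_algorithm_def by blast

lemma x_feasible: "x k \<in> feasible_blocks P"
proof (cases k)
  case 0
  then show ?thesis using algorithm unfolding generated_by_algorithm_def by blast
next
  case (Suc k')
  then show ?thesis using block_step_minimizer by (auto simp: feasible_blocks_def is_arg_min_def)
qed

lemma residual_eq: "residual P u v = (\<Sum>i\<in>blocks. cmat P i *v u) + v - rhs P"
  using block_data(5) by (simp add: residual_def cmat_mult_block)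

lemma residual_sweep:
  assumes "i \<in> blocks"
  shows "residual P (sweep P i u w v) z = residual P (sweep P i u 0 v) z + cmat P i *v w"
proof -
  have "(\<Sum>j\<in>blocks. cmat P j *v block P i w) = (\<Sum>j\<in>blocks. if i = j then cmat P i *v w else 0)"
    using block_data(5) by (intro sum.cong) (auto simp: cmat_mult_block)
  then have "(\<Sum>j\<in>blocks. cmat P j *v block P i w) = cmat P i *v w" using assms by simp
  then show ?thesis
    unfolding residual_eq sweep_eq_add_block[of P i u w]
    by (simp add: matrix_vector_right_distrib sum.distrib)
qed

lemma GDERIV_obj_last: "GDERIV (\<lambda>u. obj P (a, u)) u :> snd (G (a, u))"
proof -
  have "((\<lambda>u. (a, u)) has_derivative (\<lambda>d. (0, d))) (at u)"
    by (intro has_derivative_Pair has_derivative_const has_derivative_ident)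
  from has_derivative_compose[OF this GDERIV_obj[unfolded gderiv_def]]
  show ?thesis by (simp add: gderiv_def inner_prod_def)
qed

lemma GDERIV_obj_block:
  "GDERIV (\<lambda>w. obj P (a + block P i w, u)) w :> block P i (fst (G (a + block P i w, u)))"
proof -
  have "((\<lambda>w. (a + block P i w, u)) has_derivative (\<lambda>d. (0 + block P i d, 0))) (at w)"
    by (intro has_derivative_Pair has_derivative_add has_derivative_const
        bounded_linear.has_derivative[OF linear_linear[THEN iffD2, OF linear_block]] has_derivative_ident)
  from has_derivative_compose[OF this GDERIV_obj[unfolded gderiv_def]]
  show ?thesis by (simp add: gderiv_def inner_prod_def block_inner)
qed

lemma y_step:
  "y (Suc k) = y k - \<gamma> *\<^sub>R (snd (G (x (Suc k), y k)) - lam k + \<beta> *\<^sub>R residual P (x (Suc k)) (y k))"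
proof -
  let ?c = "\<Sum>i=1..nblocks P - 1. reg P i (block P i (x (Suc k)))"
  define R where "R = residual P (x (Suc k)) 0"
  have res: "residual P (x (Suc k)) u = R + mat 1 *v u" for u by (simp add: R_def residual_def)
  have "GDERIV (\<lambda>u. (obj P (x (Suc k), u) + ?c) +
        (\<beta> / 2 * (norm (R + mat 1 *v u))\<^sup>2 - (R + mat 1 *v u) \<bullet> lam k)) (y k)
      :> (snd (G (x (Suc k), y k)) + 0) + transpose (mat 1) *v (\<beta> *\<^sub>R (R + mat 1 *v y k) - lam k)"
    by (intro GDERIV_add GDERIV_obj_last GDERIV_const GDERIV_penalty)
  then have "GDERIV (\<lambda>u. aug_lag P \<beta> (x (Suc k)) u (lam k)) (y k)
      :> snd (G (x (Suc k), y k)) - lam k + \<beta> *\<^sub>R residual P (x (Suc k)) (y k)"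
    by (simp add: aug_lag_def res algebra_simps transpose_mat)
  from grad_eqI[OF this] show ?thesis
    using algorithm unfolding generated_by_algorithm_def by simp
qed

lemma lam_step: "lam (Suc k) = lam k - \<beta> *\<^sub>R residual P (x (Suc k)) (y (Suc k))"
  using algorithm unfolding generated_by_algorithm_def by blast

text \<open>Both updates contain the residual at \<open>x (Suc k)\<close>, once with the old and
  once with the new last block; as the last matrix is the identity, the two differ by
  \<open>y k - y (Suc k)\<close>, and the old multiplier drops out. The initial multiplier is
  arbitrary, so increments are controlled only from index 1 on, and the potential starts at iterate
  1.\<close>

lemma lam_eq: "lam (Suc k) = snd (G (x (Suc k), y k)) + (\<beta> - 1 / \<gamma>) *\<^sub>R (y k - y (Suc k))"
proof -
  have "(1 / \<gamma>) *\<^sub>R (y k - y (Suc k)) =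
      snd (G (x (Suc k), y k)) - lam k + \<beta> *\<^sub>R residual P (x (Suc k)) (y k)"
    unfolding y_step[of k] using gamma_pos by simp
  moreover have "residual P (x (Suc k)) (y k) =
      residual P (x (Suc k)) (y (Suc k)) + (y k - y (Suc k))"
    by (simp add: residual_eq)
  ultimately have "(1 / \<gamma>) *\<^sub>R (y k - y (Suc k)) = snd (G (x (Suc k), y k)) - lam k
      + \<beta> *\<^sub>R (residual P (x (Suc k)) (y (Suc k)) + (y k - y (Suc k)))" by simp
  moreover have "l - b = g + (c - e)" if "e = g - l + (b + c)" for l b g c e :: "real^'m"
    unfolding that by simp
  ultimately show ?thesis
    unfolding lam_step scaleR_left_diff_distrib scaleR_right_distrib by blast
qed

section \<open>One-step estimates for multipliers, last block and manifold blocks\<close>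

definition dx :: "nat \<Rightarrow> real" where "dx k = (norm (x k - x (Suc k)))\<^sup>2"
definition dy :: "nat \<Rightarrow> real" where "dy k = (norm (y k - y (Suc k)))\<^sup>2"

lemma dx_nonneg: "0 \<le> dx k" and dy_nonneg: "0 \<le> dy k"
  by (simp_all add: dx_def dy_def)

lemma dx_blocks: "(\<Sum>i\<in>blocks. (norm (block P i (x k) - block P i (x (Suc k))))\<^sup>2) = dx k"
  using norm_squared_blocks[OF range_block_of, of "x k - x (Suc k)"] by (simp add: dx_def block_diff)

text \<open>The gradients being compared sit at \<open>(x (Suc (Suc k)), y (Suc k))\<close> and
  \<open>(x (Suc k), y k)\<close>: the last-block argument lags behind, which brings in
  \<open>dy k\<close> with weight \<open>L\<^sup>2\<close>.\<close>

lemma norm_lam_diff: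
  fixes s defines "s \<equiv> \<beta> - 1 / \<gamma>"
  shows "(norm (lam (Suc (Suc k)) - lam (Suc k)))\<^sup>2 \<le>
    3 * L\<^sup>2 * dx (Suc k) + 3 * s\<^sup>2 * dy (Suc k) + 3 * (s\<^sup>2 + L\<^sup>2) * dy k"
proof -
  let ?g = "G (x (Suc (Suc k)), y (Suc k)) - G (x (Suc k), y k)"
  let ?a = "s *\<^sub>R (y (Suc k) - y (Suc (Suc k)))" and ?b = "(- s) *\<^sub>R (y k - y (Suc k))"
  have "lam (Suc (Suc k)) - lam (Suc k) = snd ?g + ?a + ?b"
    using lam_eq[of "Suc k", folded s_def] lam_eq[of k, folded s_def]
    by (simp only: snd_diff scaleR_minus_left) simp
  then have "(norm (lam (Suc (Suc k)) - lam (Suc k)))\<^sup>2 \<le>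
      3 * ((norm (snd ?g))\<^sup>2 + (norm ?a)\<^sup>2 + (norm ?b)\<^sup>2)"
    using norm_add3_squared_le[of "snd ?g" ?a ?b] by simp
  moreover have "(norm ?a)\<^sup>2 = s\<^sup>2 * dy (Suc k)" "(norm ?b)\<^sup>2 = s\<^sup>2 * dy k"
    by (simp_all add: power_mult_distrib dy_def)
  moreover have "(norm (snd ?g))\<^sup>2 \<le> L\<^sup>2 * (dx (Suc k) + dy k)"
  proof -
    have "norm (snd ?g) \<le> L * norm ((x (Suc (Suc k)), y (Suc k)) - (x (Suc k), y k))"
      by (rule order_trans[OF norm_proj_le(2) norm_grad_diff])
    then have "(norm (snd ?g))\<^sup>2 \<le> (L * norm ((x (Suc (Suc k)), y (Suc k)) - (x (Suc k), y k)))\<^sup>2"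
      by (intro power_mono) auto
    then show ?thesis
      by (simp add: power_mult_distrib norm_Pair dx_def dy_def norm_minus_commute)
  qed
  ultimately show ?thesis by (simp add: algebra_simps)
qed

text \<open>The objective rises above its linear model by at most \<open>L / 2\<close> times the
  squared step, the penalty by exactly \<open>\<beta> / 2\<close> times it, since the residual moves
  by precisely \<open>d\<close>. The slope along the gradient step contributes
  \<open>- 1 / \<gamma>\<close>.\<close>

lemma y_descent:
  "aug_lag P \<beta> (x (Suc k)) (y (Suc k)) (lam k) \<le>
    aug_lag P \<beta> (x (Suc k)) (y k) (lam k) - (1 / \<gamma> - (\<beta> + L) / 2) * dy k"
proof -
  let ?a = "x (Suc k)"
  define d R g where "d = y (Suc k) - y k" and "R = residual P ?a (y k)" and "g = snd (G (?a, y k))"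
  have lip: "L-lipschitz_on UNIV (\<lambda>u. snd (G (?a, u)))"
  proof (rule lipschitz_onI)
    fix u v
    show "dist (snd (G (?a, u))) (snd (G (?a, v))) \<le> L * dist u v"
      using norm_proj_le(2)[of "G (?a, u) - G (?a, v)"] norm_grad_diff[of "(?a, u)" "(?a, v)"]
      by (simp add: dist_norm norm_Pair)
  qed (use L_pos in simp)
  have f: "obj P (?a, y (Suc k)) \<le> obj P (?a, y k) + g \<bullet> d + L / 2 * (norm d)\<^sup>2"
    unfolding g_def d_def by (rule lipschitz_gradient_descent[OF GDERIV_obj_last lip])
  have res: "residual P ?a (y (Suc k)) = R + d" by (simp add: residual_eq R_def d_def)
  have "g - lam k + \<beta> *\<^sub>R R = - (1 / \<gamma>) *\<^sub>R d"
    unfolding y_step[of k] d_def g_def R_def using gamma_pos by simp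
  then have "(g - lam k + \<beta> *\<^sub>R R) \<bullet> d = - (1 / \<gamma>) * (norm d)\<^sup>2"
    by (simp add: power2_norm_eq_inner)
  then have opt: "g \<bullet> d - lam k \<bullet> d + \<beta> * (R \<bullet> d) = - (1 / \<gamma>) * (norm d)\<^sup>2"
    by (simp add: inner_diff_left inner_add_left)
  have sq: "\<beta> / 2 * (norm (R + d))\<^sup>2 = \<beta> / 2 * (norm R)\<^sup>2 + \<beta> * (R \<bullet> d) + \<beta> / 2 * (norm d)\<^sup>2"
    by (simp add: power2_norm_eq_inner inner_add_left inner_add_right inner_commute algebra_simps)
  have lin: "(R + d) \<bullet> lam k = R \<bullet> lam k + lam k \<bullet> d"
    unfolding inner_add_left by (simp add: inner_commute)
  have "dy k = (norm d)\<^sup>2" by (simp add: dy_def d_def norm_minus_commute)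
  then show ?thesis
    unfolding aug_lag_def res sq lin R_def[symmetric] using f opt
    by (simp add: algebra_simps add_divide_distrib)
qed

text \<open>The old block is a feasible competitor with zero proximal term.\<close>

lemma block_descent:
  assumes "i \<in> blocks"
  shows "aug_lag P \<beta> (sweep P i (x (Suc k)) (x (Suc k)) (x k)) (y k) (lam k)
      + 1 / 2 * (sigma_min_on (block_space P i) (H i) *
          (norm (block P i (x k) - block P i (x (Suc k))))\<^sup>2)
    \<le> aug_lag P \<beta> (sweep P i (x (Suc k)) (x k) (x k)) (y k) (lam k)"
proof -
  let ?d = "block P i (x (Suc k)) - block P i (x k)"
  have "block P i (x k) \<in> mfd P i \<inter> cvx P i"
    using x_feasible assms unfolding feasible_blocks_def by blast
  with block_step_minimizer[OF assms, of k]
  have "aug_lag P \<beta> (sweep P i (x (Suc k)) (block P i (x (Suc k))) (x k)) (y k) (lam k)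
        + 1 / 2 * (?d \<bullet> (H i *v ?d))
      \<le> aug_lag P \<beta> (sweep P i (x (Suc k)) (block P i (x k)) (x k)) (y k) (lam k)"
    unfolding is_arg_min_def by (force simp: not_less)
  moreover have "sigma_min_on (block_space P i) (H i) * (norm ?d)\<^sup>2 \<le> ?d \<bullet> (H i *v ?d)"
    using H_block[OF assms] subspace_coord_space
    by (intro sigma_min_on_le_rayleigh) (auto simp: block_space_def block_in_space[unfolded block_space_def]
        intro!: subspace_diff)
  ultimately show ?thesis by (simp add: sweep_block norm_minus_commute)
qed

lemma x_descent:
  "aug_lag P \<beta> (x (Suc k)) (y k) (lam k)
    + (\<Sum>i\<in>blocks. 1 / 2 * (sigma_min_on (block_space P i) (H i) *
        (norm (block P i (x k) - block P i (x (Suc k))))\<^sup>2))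
    \<le> aug_lag P \<beta> (x k) (y k) (lam k)"
proof -
  let ?q = "\<lambda>i. 1 / 2 * (sigma_min_on (block_space P i) (H i) *
    (norm (block P i (x k) - block P i (x (Suc k))))\<^sup>2)"
  let ?L = "\<lambda>i. aug_lag P \<beta> (sweep P i (x (Suc k)) (x (Suc k)) (x k)) (y k) (lam k)"
  have "?L n + (\<Sum>i=1..n. ?q i) \<le> ?L 0" if "n \<le> nblocks P - 1" for n
    using that
  proof (induction n)
    case (Suc n)
    then have "?L (Suc n) + ?q (Suc n) \<le> ?L n"
      using block_descent[of "Suc n" k] by (simp add: sweep_Suc)
    then show ?case using Suc by simp
  qed simp
  from this[OF order_refl] show ?thesis
    using sweep_ends[OF range_block_of, of "x (Suc k)" "x k"] by simp
qed

text \<open>In the multiplier the augmented Lagrangian is affine with slope minus the residual, and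
  the update moves along exactly that direction.\<close>

lemma lam_ascent:
  "aug_lag P \<beta> (x (Suc k)) (y (Suc k)) (lam (Suc k)) =
    aug_lag P \<beta> (x (Suc k)) (y (Suc k)) (lam k) + 1 / \<beta> * (norm (lam (Suc k) - lam k))\<^sup>2"
proof -
  let ?R = "residual P (x (Suc k)) (y (Suc k))"
  have "1 / \<beta> * (norm (lam (Suc k) - lam k))\<^sup>2 = \<beta> * (?R \<bullet> ?R)"
    using beta_pos
    by (simp add: lam_step power_mult_distrib power2_eq_square[of \<beta>] power2_norm_eq_inner)
  then show ?thesis
    by (simp add: aug_lag_def lam_step inner_diff_right)
qed

section \<open>Descent and lower bound of the potential\<close>

definition Psi :: "nat \<Rightarrow> real" where
  "Psi k = potential P L \<beta> \<gamma> (x (Suc k)) (y (Suc k)) (lam (Suc k)) (y k)"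

definition step_gain :: real where
  "step_gain = min (- ((\<beta> + L) / 2 - 1 / \<gamma> + 6 / \<beta> * (\<beta> - 1 / \<gamma>)\<^sup>2 + 3 * L\<^sup>2 / \<beta>))
     (MIN i\<in>blocks. - (3 * L\<^sup>2 / \<beta> - sigma_min_on (block_space P i) (H i) / 2))"

text \<open>The summand of \<open>Psi k\<close> cancels the \<open>dy k\<close> part of the
  multiplier increment. Its counterpart in \<open>Psi (Suc k)\<close> joins the multiplier part of
  \<open>dy (Suc k)\<close>, which turns 3 into 6 in front of
  \<open>(\<beta> - 1 / \<gamma>)\<^sup>2\<close>.\<close>

lemma Psi_descent: "Psi (Suc k) \<le> Psi k - step_gain * (dx (Suc k) + dy (Suc k))"
proof -
  let ?s = "\<beta> - 1 / \<gamma>"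
  let ?\<sigma> = "\<lambda>i. sigma_min_on (block_space P i) (H i)"
  let ?n = "\<lambda>i. (norm (block P i (x (Suc k)) - block P i (x (Suc (Suc k)))))\<^sup>2"
  have "(3 * L\<^sup>2 / \<beta> + step_gain) * ?n i \<le> 1 / 2 * (?\<sigma> i * ?n i)" if "i \<in> blocks" for i
  proof -
    have "step_gain \<le> - (3 * L\<^sup>2 / \<beta> - ?\<sigma> i / 2)"
      unfolding step_gain_def using that by (intro min.coboundedI2 Min_le) auto
    then have "(3 * L\<^sup>2 / \<beta> + step_gain) * ?n i \<le> (?\<sigma> i / 2) * ?n i"
      by (intro mult_right_mono) auto
    then show ?thesis by simp
  qed
  then have "(\<Sum>i\<in>blocks. (3 * L\<^sup>2 / \<beta> + step_gain) * ?n i) \<le> (\<Sum>i\<in>blocks. 1 / 2 * (?\<sigma> i * ?n i))"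
    by (rule sum_mono)
  then have sx: "(3 * L\<^sup>2 / \<beta> + step_gain) * dx (Suc k) \<le> (\<Sum>i\<in>blocks. 1 / 2 * (?\<sigma> i * ?n i))"
    by (simp only: dx_blocks flip: sum_distrib_left)
  have "step_gain \<le> - ((\<beta> + L) / 2 - 1 / \<gamma> + 6 / \<beta> * ?s\<^sup>2 + 3 * L\<^sup>2 / \<beta>)"
    by (simp add: step_gain_def)
  then have sy: "(step_gain + (\<beta> + L) / 2 - 1 / \<gamma> + 6 / \<beta> * ?s\<^sup>2 + 3 * L\<^sup>2 / \<beta>) * dy (Suc k) \<le> 0"
    using dy_nonneg[of "Suc k"] by (intro mult_nonpos_nonneg) auto
  have "1 / \<beta> * (norm (lam (Suc (Suc k)) - lam (Suc k)))\<^sup>2 \<le>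
      1 / \<beta> * (3 * L\<^sup>2 * dx (Suc k) + 3 * ?s\<^sup>2 * dy (Suc k) + 3 * (?s\<^sup>2 + L\<^sup>2) * dy k)"
    using norm_lam_diff[of k] beta_pos by (intro mult_left_mono) auto
  then have sl: "1 / \<beta> * (norm (lam (Suc (Suc k)) - lam (Suc k)))\<^sup>2 \<le>
      3 * L\<^sup>2 / \<beta> * dx (Suc k) + 3 / \<beta> * ?s\<^sup>2 * dy (Suc k) + 3 / \<beta> * (?s\<^sup>2 + L\<^sup>2) * dy k"
    by (simp add: algebra_simps)
  have "Psi (Suc k) = aug_lag P \<beta> (x (Suc (Suc k))) (y (Suc (Suc k))) (lam (Suc (Suc k)))
      + 3 / \<beta> * (?s\<^sup>2 + L\<^sup>2) * dy (Suc k)"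
    and "Psi k = aug_lag P \<beta> (x (Suc k)) (y (Suc k)) (lam (Suc k)) + 3 / \<beta> * (?s\<^sup>2 + L\<^sup>2) * dy k"
    by (simp_all add: Psi_def potential_def dy_def)
  then show ?thesis
    using sx sy sl lam_ascent[of "Suc k"] y_descent[of "Suc k"] x_descent[of "Suc k"]
    by (simp add: algebra_simps)
qed

text \<open>By polarization in \<open>lam k = lam (Suc k) + \<beta> *\<^sub>R R\<close>, with
  \<open>R\<close> the new residual, the multiplier term equals the telescoping difference plus
  \<open>\<beta> / 2 * (norm R)\<^sup>2\<close>; both penalty contributions are nonnegative and
  dropped.\<close>

lemma aug_lag_lower_bound:
  "(\<Sum>i\<in>blocks. reg_opt P i) + obj_opt P + 1 / (2 * \<beta>) * ((norm (lam (Suc k)))\<^sup>2 - (norm (lam k))\<^sup>2)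
    \<le> aug_lag P \<beta> (x (Suc k)) (y (Suc k)) (lam (Suc k))"
proof -
  let ?R = "residual P (x (Suc k)) (y (Suc k))" and ?l = "lam (Suc k)"
  have "bdd_below (obj P ` (feasible_blocks P \<times> UNIV))"
    using standing by (simp add: standing_assumptions_def)
  then have f: "obj_opt P \<le> obj P (x (Suc k), y (Suc k))"
    unfolding obj_opt_def using x_feasible by (intro cINF_lower) auto
  have r: "(\<Sum>i\<in>blocks. reg_opt P i) \<le> (\<Sum>i\<in>blocks. reg P i (block P i (x (Suc k))))"
    unfolding reg_opt_def
    using x_feasible block_data(6) by (intro sum_mono cINF_lower) (auto simp: feasible_blocks_def)
  have "lam k = ?l + \<beta> *\<^sub>R ?R" by (simp add: lam_step)
  then have "(norm (lam k))\<^sup>2 = (norm ?l)\<^sup>2 + 2 * \<beta> * (?R \<bullet> ?l) + \<beta>\<^sup>2 * (norm ?R)\<^sup>2"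
    by (simp add: power2_norm_eq_inner inner_add_left inner_add_right inner_commute
        power2_eq_square[of \<beta>] algebra_simps)
  then have eq: "1 / (2 * \<beta>) * ((norm ?l)\<^sup>2 - (norm (lam k))\<^sup>2) = - (?R \<bullet> ?l) - \<beta> / 2 * (norm ?R)\<^sup>2"
    using beta_pos by (simp add: field_simps power2_eq_square)
  have "0 \<le> \<beta> / 2 * (norm ?R)\<^sup>2" using beta_pos by simp
  then show ?thesis
    unfolding aug_lag_def eq using f r by linarith
qed

lemma Psi_lower_bound:
  assumes "step_gain \<ge> 0"
  shows "(\<Sum>i\<in>blocks. reg_opt P i) + obj_opt P \<le> Psi k"
proof (rule decreasing_ge_of_telescoping[where s = "\<lambda>k. 1 / (2 * \<beta>) * (norm (lam (Suc k)))\<^sup>2"])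
  fix k
  have "0 \<le> step_gain * (dx (Suc k) + dy (Suc k))"
    using assms dx_nonneg dy_nonneg by simp
  then show "Psi (Suc k) \<le> Psi k" using Psi_descent[of k] by linarith
  have "aug_lag P \<beta> (x (Suc (Suc k))) (y (Suc (Suc k))) (lam (Suc (Suc k))) \<le> Psi (Suc k)"
    using beta_pos by (simp add: Psi_def potential_def)
  then show "1 / (2 * \<beta>) * (norm (lam (Suc (Suc k))))\<^sup>2 - 1 / (2 * \<beta>) * (norm (lam (Suc k)))\<^sup>2
      \<le> Psi (Suc k) - ((\<Sum>i\<in>blocks. reg_opt P i) + obj_opt P)"
    using aug_lag_lower_bound[of "Suc k"] by (simp add: right_diff_distrib)
  show "0 \<le> 1 / (2 * \<beta>) * (norm (lam (Suc k)))\<^sup>2" using beta_pos by simp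
qed

lemma sum_steps_le:
  assumes "step_gain \<ge> 0"
  shows "step_gain * (\<Sum>k<n. dx (Suc k) + dy (Suc k))
    \<le> Psi 0 - (\<Sum>i\<in>blocks. reg_opt P i) - obj_opt P"
proof -
  have "step_gain * (\<Sum>k<n. dx (Suc k) + dy (Suc k)) \<le> Psi 0 - Psi n"
  proof (induction n)
    case (Suc n)
    then show ?case using Psi_descent[of n] by (simp add: distrib_left)
  qed simp
  then show ?thesis using Psi_lower_bound[OF assms, of n] by simp
qed

section \<open>Stationarity residuals in terms of step lengths\<close>

lemma norm_last_grad_le:
  "(norm (snd (G (x (Suc k), y (Suc k))) - lam (Suc k)))\<^sup>2 \<le> (\<bar>\<beta> - 1 / \<gamma>\<bar> + L)\<^sup>2 * dy k"
proof -
  let ?s = "\<beta> - 1 / \<gamma>" and ?d = "y k - y (Suc k)"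
  let ?g = "G (x (Suc k), y (Suc k)) - G (x (Suc k), y k)"
  have "snd (G (x (Suc k), y (Suc k))) - lam (Suc k) = snd ?g - ?s *\<^sub>R ?d"
    using lam_eq[of k] by (simp only: snd_diff) simp
  then have "norm (snd (G (x (Suc k), y (Suc k))) - lam (Suc k)) \<le> norm (snd ?g) + norm (?s *\<^sub>R ?d)"
    using norm_triangle_ineq4 by metis
  also have "norm (snd ?g) \<le> L * norm ((x (Suc k), y (Suc k)) - (x (Suc k), y k))"
    by (rule order_trans[OF norm_proj_le(2) norm_grad_diff])
  also have "\<dots> = L * norm ?d" by (simp add: norm_Pair norm_minus_commute)
  finally have "norm (snd (G (x (Suc k), y (Suc k))) - lam (Suc k)) \<le> (\<bar>?s\<bar> + L) * norm ?d"
    by (simp add: distrib_right add.commute)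
  then have "(norm (snd (G (x (Suc k), y (Suc k))) - lam (Suc k)))\<^sup>2 \<le> ((\<bar>?s\<bar> + L) * norm ?d)\<^sup>2"
    by (intro power_mono) auto
  then show ?thesis by (simp add: power_mult_distrib dy_def)
qed

text \<open>The residual is the multiplier increment divided by \<beta>, up to sign. All
  coefficients are raised to the largest one, which gives \<kappa>1.\<close>

lemma norm_residual_le:
  "(norm (residual P (x (Suc (Suc k))) (y (Suc (Suc k)))))\<^sup>2
    \<le> 3 / \<beta>\<^sup>2 * ((\<beta> - 1 / \<gamma>)\<^sup>2 + L\<^sup>2) * (dx (Suc k) + dy (Suc k) + dy k)"
proof -
  let ?R = "residual P (x (Suc (Suc k))) (y (Suc (Suc k)))" and ?s = "\<beta> - 1 / \<gamma>"
  have "(norm (lam (Suc (Suc k)) - lam (Suc k)))\<^sup>2 = \<beta>\<^sup>2 * (norm ?R)\<^sup>2"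
    by (simp add: lam_step power_mult_distrib)
  then have "\<beta>\<^sup>2 * (norm ?R)\<^sup>2 \<le>
      3 * L\<^sup>2 * dx (Suc k) + 3 * ?s\<^sup>2 * dy (Suc k) + 3 * (?s\<^sup>2 + L\<^sup>2) * dy k"
    using norm_lam_diff[of k] by simp
  also have "\<dots> \<le> 3 * (?s\<^sup>2 + L\<^sup>2) * dx (Suc k) + 3 * (?s\<^sup>2 + L\<^sup>2) * dy (Suc k) + 3 * (?s\<^sup>2 + L\<^sup>2) * dy k"
    using dx_nonneg dy_nonneg by (intro add_mono mult_right_mono) auto
  also have "\<dots> = \<beta>\<^sup>2 * (3 / \<beta>\<^sup>2 * (?s\<^sup>2 + L\<^sup>2) * (dx (Suc k) + dy (Suc k) + dy k))"
  proof -
    have "3 * c * X + 3 * c * Y + 3 * c * Z = \<beta>\<^sup>2 * (3 / \<beta>\<^sup>2 * c * (X + Y + Z))" for c X Y Z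
      using beta_pos by (simp add: field_simps)
    then show ?thesis .
  qed
  finally show ?thesis
    by (rule mult_left_le_imp_le) (use beta_pos in simp)
qed

lemma sum_block_norms_le:
  "(\<Sum>j\<in>blocks. norm (block P j u)) + norm v \<le> sqrt (nblocks P) * norm (u, v)"
proof -
  \<comment> \<open>Slot 0 holds the last block, so there are \<open>nblocks P\<close> entries, and
    Cauchy-Schwarz against ones yields the \<open>sqrt N\<close> of \<kappa>3.\<close>
  define b where "b j = (if j = 0 then norm v else norm (block P j u))" for j
  have split: "(\<Sum>j=0..nblocks P - 1. g (b j)) = g (norm v) + (\<Sum>j\<in>blocks. g (norm (block P j u)))"
    for g :: "real \<Rightarrow> real"
    by (simp add: sum.atLeast_Suc_atMost b_def)
  have "(\<Sum>j=0..nblocks P - 1. b j * 1)\<^sup>2 \<le> (\<Sum>j=0..nblocks P - 1. (b j)\<^sup>2) * (\<Sum>j=0..nblocks P - 1. 1\<^sup>2)"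
    by (rule Cauchy_Schwarz_ineq_sum)
  also have "(\<Sum>j=0..nblocks P - 1. 1\<^sup>2) = real (nblocks P)" using nblocks by simp
  also have "(\<Sum>j=0..nblocks P - 1. (b j)\<^sup>2) = (norm (u, v))\<^sup>2"
    unfolding split[of "\<lambda>t. t\<^sup>2"] norm_squared_blocks[OF range_block_of] by (simp add: norm_Pair)
  finally have "((\<Sum>j\<in>blocks. norm (block P j u)) + norm v)\<^sup>2 \<le> (norm (u, v))\<^sup>2 * nblocks P"
    using split[of "\<lambda>t. t"] by (simp add: add.commute)
  then have "(\<Sum>j\<in>blocks. norm (block P j u)) + norm v \<le> sqrt ((norm (u, v))\<^sup>2 * nblocks P)"
    by (rule real_le_rsqrt)
  then show ?thesis by (simp add: real_sqrt_mult mult.commute)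
qed

lemma norm_transpose_residual_diff_le:
  assumes i: "i \<in> blocks" and A: "\<And>j. j \<in> blocks \<Longrightarrow> (mat_norm2 (cmat P j))\<^sup>2 \<le> a"
    and I: "(mat_norm2 (mat 1 :: real^'m^'m))\<^sup>2 \<le> a"
  shows "norm (transpose (cmat P i) *v (residual P u v - residual P u' v'))
    \<le> a * (sqrt (nblocks P) * norm (u - u', v - v'))"
proof -
  let ?n = "mat_norm2 (cmat P i)"
  \<comment> \<open>A product of two matrix norms is at most the larger of their squares; hence
    \<kappa>3 contains a maximum of squared norms.\<close>
  have amgm: "?n * t \<le> a" if "t\<^sup>2 \<le> a" for t
    using sum_squares_bound[of ?n t] A[OF i] that by simp
  have "residual P u v - residual P u' v' =
      (\<Sum>j\<in>blocks. cmat P j *v block P j (u - u')) + mat 1 *v (v - v')"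
    by (simp add: residual_def block_diff matrix_vector_mult_diff_distrib sum_subtractf)
  then have "norm (residual P u v - residual P u' v')
      \<le> norm (\<Sum>j\<in>blocks. cmat P j *v block P j (u - u')) + norm (mat 1 *v (v - v'))"
    by (simp only: norm_triangle_ineq)
  also have "\<dots> \<le> (\<Sum>j\<in>blocks. norm (cmat P j *v block P j (u - u'))) + norm (mat 1 *v (v - v'))"
    by (intro add_right_mono norm_sum)
  also have "\<dots> \<le> (\<Sum>j\<in>blocks. mat_norm2 (cmat P j) * norm (block P j (u - u')))
      + mat_norm2 (mat 1 :: real^'m^'m) * norm (v - v')"
    by (intro add_mono sum_mono mat_norm2_bound)
  finally have "?n * norm (residual P u v - residual P u' v') \<le>
      ?n * ((\<Sum>j\<in>blocks. mat_norm2 (cmat P j) * norm (block P j (u - u')))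
      + mat_norm2 (mat 1 :: real^'m^'m) * norm (v - v'))"
    by (intro mult_left_mono mat_norm2_nonneg)
  also have "\<dots> = (\<Sum>j\<in>blocks. (?n * mat_norm2 (cmat P j)) * norm (block P j (u - u')))
      + (?n * mat_norm2 (mat 1 :: real^'m^'m)) * norm (v - v')"
    by (simp add: distrib_left sum_distrib_left mult.assoc)
  also have "\<dots> \<le> (\<Sum>j\<in>blocks. a * norm (block P j (u - u'))) + a * norm (v - v')"
    using amgm A I by (intro add_mono sum_mono mult_right_mono) auto
  also have "\<dots> = a * ((\<Sum>j\<in>blocks. norm (block P j (u - u'))) + norm (v - v'))"
    by (simp add: distrib_left sum_distrib_left)
  also have "\<dots> \<le> a * (sqrt (nblocks P) * norm (u - u', v - v'))"
    using A[OF i] order_trans[OF zero_le_power2 A[OF i]]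
    by (intro mult_left_mono sum_block_norms_le) auto
  finally show ?thesis using mat_norm2_transpose_bound order_trans by blast
qed

text \<open>Optimality of the subproblem holds at a mixed point: blocks up to \<open>i\<close> new,
  later blocks, last block and multiplier old. Stationarity is asked at the new iterate. The
  discrepancy consists of a gradient difference, a residual difference and the proximal term, whose
  bounds are the three summands in the root of \<kappa>3.\<close>

lemma block_stationarity:
  assumes i: "i \<in> blocks" and chart: "slice_chart (mfd P i) D V \<phi>" "block P i (x (Suc k)) \<in> V"
    and A: "\<And>j. j \<in> blocks \<Longrightarrow> (mat_norm2 (cmat P j))\<^sup>2 \<le> a"
    and I: "(mat_norm2 (mat 1 :: real^'m^'m))\<^sup>2 \<le> a" and h: "mat_norm2 (H i) \<le> h"
  shows "setdist
      (orth_proj (tangent_space (mfd P i) (block P i (x (Suc k)))) `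
        {- block P i (fst (G (x (Suc k), y (Suc k)))) + transpose (cmat P i) *v lam (Suc k) - g |g.
          g \<in> subdiff (block_space P i) (reg P i) (block P i (x (Suc k)))})
      (mfd_normal_cone (mfd P i) (cvx P i \<inter> mfd P i) V \<phi> (block P i (x (Suc k))))
    \<le> (L + \<beta> * sqrt (nblocks P) * a + h) * sqrt (dx k + dy k)"
proof -
  define xn xo where "xn = x (Suc k)" and "xo = x k"
  define w0 where "w0 = block P i xn"
  define z0 where "z0 = sweep P i xn 0 xo"
  define z where "z = sweep P i xn xn xo"
  define R where "R = residual P z0 (y k)"
  have sw: "sweep P i xn w xo = z0 + block P i w" for w
    unfolding z0_def by (rule sweep_eq_add_block)
  have res: "residual P (sweep P i xn w xo) (y k) = R + cmat P i *v w" for w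
    unfolding R_def z0_def by (rule residual_sweep[OF i])
  have z_w0: "z = z0 + block P i w0" "residual P z (y k) = R + cmat P i *v w0"
    using sw[of w0] res[of w0] by (simp_all add: z_def w0_def sweep_block)
  define F where "F w = obj P (z0 + block P i w, y k)
      + (\<beta> / 2 * (norm (R + cmat P i *v w))\<^sup>2 - (R + cmat P i *v w) \<bullet> lam k)
      + 1 / 2 * ((w - block P i xo) \<bullet> (H i *v (w - block P i xo)))" for w
  define c where "c = block P i (fst (G (z, y k)))
      + transpose (cmat P i) *v (\<beta> *\<^sub>R residual P z (y k) - lam k) + H i *v (w0 - block P i xo)"
  define d where "d = - block P i (fst (G (xn, y (Suc k)))) + transpose (cmat P i) *v lam (Suc k)"
  have "transpose (H i) = H i" using H_block(1)[OF i] by (simp add: pos_def_on_def)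
  then have "GDERIV F w0 :> c"
    unfolding F_def c_def z_w0(2) unfolding z_w0(1)
    by (intro GDERIV_add GDERIV_obj_block GDERIV_penalty GDERIV_quadratic_form)
  moreover have "F w0 + reg P i w0 \<le> F w + reg P i w" if w: "w \<in> cvx P i \<inter> mfd P i" for w
  proof -
    \<comment> \<open>The regularizers of the other blocks are constant in \<open>w\<close> and do
      not affect the comparison.\<close>
    let ?c = "\<Sum>j\<in>blocks - {i}. reg P j (block P j (if j < i then xn else xo))"
    let ?obj = "\<lambda>w. aug_lag P \<beta> (sweep P i xn w xo) (y k) (lam k)
        + 1 / 2 * ((w - block P i xo) \<bullet> (H i *v (w - block P i xo)))"
    have split: "?obj w = F w + reg P i w + ?c" if "w \<in> block_space P i" for w
    proof -
      have "(\<Sum>j\<in>blocks - {i}. reg P j (block P j (sweep P i xn w xo))) = ?c"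
        by (intro sum.cong) (auto simp: block_sweep)
      then have "(\<Sum>j\<in>blocks. reg P j (block P j (sweep P i xn w xo))) = reg P i w + ?c"
        using sum.remove[OF finite_atLeastAtMost i, of "\<lambda>j. reg P j (block P j (sweep P i xn w xo))"]
        by (simp only: block_sweep block_id[OF that] less_irrefl if_False if_True refl)
      then show ?thesis unfolding aug_lag_def res unfolding F_def sw by simp
    qed
    have "?obj w0 \<le> ?obj w"
      using block_step_minimizer[OF i, of k] w
      unfolding is_arg_min_def w0_def xn_def xo_def by (force simp: not_less)
    moreover have "w \<in> block_space P i" using w block_data(3)[OF i] by blast
    ultimately show ?thesis
      using split block_in_space[of P i xn] by (simp add: w0_def)
  qed
  moreover have "w0 \<in> cvx P i \<inter> mfd P i"
    using x_feasible[of "Suc k"] i by (auto simp: feasible_blocks_def w0_def xn_def)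
  moreover have "w0 \<in> V" using chart(2) by (simp add: w0_def xn_def)
  moreover have "cvx P i \<inter> mfd P i \<subseteq> coord_space (coords P i)"
    using block_data(3)[OF i] by (auto simp: block_space_def)
  ultimately have "setdist (orth_proj (tangent_space (mfd P i) w0) `
        {d - g |g. g \<in> subdiff (coord_space (coords P i)) (reg P i) w0})
      (mfd_normal_cone (mfd P i) (cvx P i \<inter> mfd P i) V \<phi> w0) \<le> norm (c + d)"
    using block_data(1,2)[OF i]
    by (intro stationarity_setdist_le[OF block_data(4)[OF i] chart(1), where h = F])
       (auto simp: block_space_def)
  \<comment> \<open>The new multiplier is the old one minus \<beta> times the new residual, so the
    two multipliers leave a difference of residuals.\<close>
  also have "c + d = block P i (fst (G (z, y k) - G (xn, y (Suc k))))
      + \<beta> *\<^sub>R (transpose (cmat P i) *v (residual P z (y k) - residual P xn (y (Suc k))))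
      + H i *v (w0 - block P i xo)"
    unfolding c_def d_def lam_step[of k] xn_def
    by (simp add: block_diff matrix_vector_mult_diff_distrib matrix_vector_mult_scaleR
        scaleR_diff_right)
  also have "norm \<dots> \<le> L * norm (z - xn, y k - y (Suc k))
      + \<beta> * (a * (sqrt (nblocks P) * norm (z - xn, y k - y (Suc k)))) + h * norm (xn - xo)"
  proof (intro norm_triangle_mono)
    have "norm (block P i (fst (G (z, y k) - G (xn, y (Suc k))))) \<le> norm (G (z, y k) - G (xn, y (Suc k)))"
      using norm_block_le norm_proj_le(1) order_trans by blast
    also have "\<dots> \<le> L * norm ((z, y k) - (xn, y (Suc k)))" by (rule norm_grad_diff)
    finally show "norm (block P i (fst (G (z, y k) - G (xn, y (Suc k)))))
        \<le> L * norm (z - xn, y k - y (Suc k))" by simp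
    show "norm (\<beta> *\<^sub>R (transpose (cmat P i) *v (residual P z (y k) - residual P xn (y (Suc k)))))
        \<le> \<beta> * (a * (sqrt (nblocks P) * norm (z - xn, y k - y (Suc k))))"
      using norm_transpose_residual_diff_le[OF i A I] beta_pos by simp
    have "norm (H i *v (w0 - block P i xo)) \<le> mat_norm2 (H i) * norm (w0 - block P i xo)"
      by (rule mat_norm2_bound)
    also have "\<dots> \<le> h * norm (xn - xo)"
      using h mat_norm2_nonneg[of "H i"] norm_block_le[of P i "xn - xo"]
      by (intro mult_mono) (auto simp: w0_def block_diff)
    finally show "norm (H i *v (w0 - block P i xo)) \<le> h * norm (xn - xo)" .
  qed
  also have "\<dots> \<le> L * sqrt (dx k + dy k) + \<beta> * (a * (sqrt (nblocks P) * sqrt (dx k + dy k)))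
      + h * sqrt (dx k + dy k)"
  proof -
    have "(norm (z - xn))\<^sup>2 \<le> dx k"
      unfolding dx_def z_def xn_def xo_def by (intro power_mono norm_sweep_diff_le) simp
    then have "norm (z - xn, y k - y (Suc k)) \<le> sqrt (dx k + dy k)"
      by (simp add: norm_Pair dy_def)
    moreover have "norm (xn - xo) \<le> sqrt (dx k + dy k)"
      by (rule real_le_rsqrt) (simp add: dx_def dy_def xn_def xo_def norm_minus_commute)
    moreover have "0 \<le> a" using I zero_le_power2 order_trans by blast
    moreover have "0 \<le> h" using h mat_norm2_nonneg order_trans by blast
    ultimately show ?thesis
      using L_pos beta_pos by (intro add_mono mult_left_mono) auto
  qed
  also have "\<dots> = (L + \<beta> * sqrt (nblocks P) * a + h) * sqrt (dx k + dy k)"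
    by (simp add: algebra_simps)
  finally show ?thesis
    unfolding d_def w0_def xn_def block_space_def .
qed

text \<open>Feasibility is measured by a multiplier increment, which reaches back one iteration
  further; this is why a pair of consecutive steps has to be short.\<close>

lemma eps_stationary_of_small_steps:
  assumes A: "\<And>j. j \<in> blocks \<Longrightarrow> (mat_norm2 (cmat P j))\<^sup>2 \<le> a"
    and I: "(mat_norm2 (mat 1 :: real^'m^'m))\<^sup>2 \<le> a" and h: "\<And>i. i \<in> blocks \<Longrightarrow> mat_norm2 (H i) \<le> h"
    and e: "\<epsilon> > 0"
    and small1: "3 / \<beta>\<^sup>2 * ((\<beta> - 1 / \<gamma>)\<^sup>2 + L\<^sup>2) * (dx (Suc k) + dy (Suc k) + (dx k + dy k)) \<le> \<epsilon>\<^sup>2"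
    and small2: "(\<bar>\<beta> - 1 / \<gamma>\<bar> + L)\<^sup>2 * (dx (Suc k) + dy (Suc k) + (dx k + dy k)) \<le> \<epsilon>\<^sup>2"
    and small3: "(L + \<beta> * sqrt (nblocks P) * a + h)\<^sup>2 *
        (dx (Suc k) + dy (Suc k) + (dx k + dy k)) \<le> \<epsilon>\<^sup>2"
  shows "eps_stationary P \<epsilon> (x (Suc (Suc k))) (y (Suc (Suc k))) (lam (Suc (Suc k)))"
  unfolding eps_stationary_def
proof (intro conjI ballI allI impI)
  note nonneg = dx_nonneg[of k] dy_nonneg[of k] dx_nonneg[of "Suc k"] dy_nonneg[of "Suc k"]
  let ?\<theta> = "dx (Suc k) + dy (Suc k) + (dx k + dy k)"
  have "(\<bar>\<beta> - 1 / \<gamma>\<bar> + L)\<^sup>2 * dy (Suc k) \<le> (\<bar>\<beta> - 1 / \<gamma>\<bar> + L)\<^sup>2 * ?\<theta>"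
    using nonneg by (intro mult_left_mono) auto
  then have "(norm (snd (G (x (Suc (Suc k)), y (Suc (Suc k)))) - lam (Suc (Suc k))))\<^sup>2 \<le> \<epsilon>\<^sup>2"
    using norm_last_grad_le[of "Suc k"] small2 by linarith
  then show "norm (snd (G (x (Suc (Suc k)), y (Suc (Suc k)))) - transpose (mat 1) *v lam (Suc (Suc k))) \<le> \<epsilon>"
    unfolding transpose_mat matrix_vector_mul_lid by (rule power2_le_imp_le) (use e in simp)
  have "3 / \<beta>\<^sup>2 * ((\<beta> - 1 / \<gamma>)\<^sup>2 + L\<^sup>2) * (dx (Suc k) + dy (Suc k) + dy k)
      \<le> 3 / \<beta>\<^sup>2 * ((\<beta> - 1 / \<gamma>)\<^sup>2 + L\<^sup>2) * ?\<theta>"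
    using nonneg by (intro mult_left_mono) auto
  then have "(norm (residual P (x (Suc (Suc k))) (y (Suc (Suc k)))))\<^sup>2 \<le> \<epsilon>\<^sup>2"
    using norm_residual_le[of k] small1 by linarith
  then show "norm (residual P (x (Suc (Suc k))) (y (Suc (Suc k)))) \<le> \<epsilon>"
    by (rule power2_le_imp_le) (use e in simp)
next
  fix i assume i: "i \<in> blocks"
  then show "block P i (x (Suc (Suc k))) \<in> mfd P i \<inter> cvx P i"
    using x_feasible unfolding feasible_blocks_def by blast
  fix D V \<phi> assume c: "slice_chart (mfd P i) D V \<phi> \<and> block P i (x (Suc (Suc k))) \<in> V"
  let ?c = "L + \<beta> * sqrt (nblocks P) * a + h" and ?\<theta> = "dx (Suc k) + dy (Suc k) + (dx k + dy k)"
  have "?c\<^sup>2 * (dx (Suc k) + dy (Suc k)) \<le> ?c\<^sup>2 * ?\<theta>"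
    using dx_nonneg[of k] dy_nonneg[of k] by (intro mult_left_mono) auto
  then have "(?c * sqrt (dx (Suc k) + dy (Suc k)))\<^sup>2 \<le> \<epsilon>\<^sup>2"
    using dx_nonneg[of "Suc k"] dy_nonneg[of "Suc k"] small3 by (simp add: power_mult_distrib)
  then have "?c * sqrt (dx (Suc k) + dy (Suc k)) \<le> \<epsilon>"
    by (rule power2_le_imp_le) (use e in simp)
  then show "setdist
      (orth_proj (tangent_space (mfd P i) (block P i (x (Suc (Suc k))))) `
        {- block P i (fst (G (x (Suc (Suc k)), y (Suc (Suc k)))))
           + transpose (cmat P i) *v lam (Suc (Suc k)) - g |g.
          g \<in> subdiff (block_space P i) (reg P i) (block P i (x (Suc (Suc k))))})
      (mfd_normal_cone (mfd P i) (cvx P i \<inter> mfd P i) V \<phi> (block P i (x (Suc (Suc k))))) \<le> \<epsilon>"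
    using block_stationarity[OF i conjunct1[OF c] conjunct2[OF c] A I h[OF i]] by linarith
qed

end

section \<open>The complexity bound\<close>

text \<open>Multiplied by \<open>24 * \<beta>\<close>, the expression is
  \<open>(12 * s - 13 * \<beta>)\<^sup>2 - D\<close> with \<open>s = 1 / \<gamma>\<close>, so the
  endpoints for \<gamma> are the reciprocals of its roots in \<open>s\<close>. The bound on \<beta>
  comes from \<open>13 * D = (13 * \<beta> - 6 * L)\<^sup>2 - (18 * sqrt 3 *
  L)\<^sup>2\<close>.\<close>

lemma step_size_quadratic_neg:
  fixes \<beta> \<gamma> L :: real
  assumes L: "L > 0" and beta: "\<beta> > (6 + 18 * sqrt 3) / 13 * L"
    and gamma: "\<gamma> \<in> {12 / (13 * \<beta> + sqrt (13 * \<beta>\<^sup>2 - 12 * \<beta> * L - 72 * L\<^sup>2)) <..<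
                     12 / (13 * \<beta> - sqrt (13 * \<beta>\<^sup>2 - 12 * \<beta> * L - 72 * L\<^sup>2))}"
  shows "(\<beta> + L) / 2 - 1 / \<gamma> + 6 / \<beta> * (\<beta> - 1 / \<gamma>)\<^sup>2 + 3 * L\<^sup>2 / \<beta> < 0"
proof -
  define D where "D = 13 * \<beta>\<^sup>2 - 12 * \<beta> * L - 72 * L\<^sup>2"
  define s where "s = 1 / \<gamma>"
  have b0: "\<beta> > 0" using beta L by (smt (verit) divide_pos_pos mult_pos_pos real_sqrt_gt_0_iff)
  have "13 * \<beta> - 6 * L > 18 * sqrt 3 * L" using beta by (simp add: field_simps)
  then have "(13 * \<beta> - 6 * L)\<^sup>2 > (18 * sqrt 3 * L)\<^sup>2"
    using L by (intro power_strict_mono) auto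
  then have D0: "D > 0" by (simp add: D_def power_mult_distrib power2_diff)
  \<comment> \<open>Keeps the denominator \<open>13 * \<beta> - sqrt D\<close> positive, so that the
    bounds on \<gamma> can be inverted.\<close>
  have "D < (13 * \<beta>)\<^sup>2"
    using b0 L by (simp add: D_def power_mult_distrib) (smt (verit) mult_pos_pos zero_less_power)
  then have r: "sqrt D < 13 * \<beta>" using b0 by (intro real_less_lsqrt) auto
  have r0: "sqrt D > 0" using D0 by simp
  have g: "12 / (13 * \<beta> + sqrt D) < \<gamma>" "\<gamma> < 12 / (13 * \<beta> - sqrt D)"
    using gamma by (simp_all add: D_def)
  have g0: "\<gamma> > 0" using g(1) b0 r0 by (smt (verit) divide_pos_pos)
  have "12 * s < 13 * \<beta> + sqrt D" "13 * \<beta> - sqrt D < 12 * s"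
    using g g0 b0 r r0 by (simp_all add: s_def field_simps)
  then have "\<bar>12 * s - 13 * \<beta>\<bar> < sqrt D" by linarith
  then have "\<bar>12 * s - 13 * \<beta>\<bar>\<^sup>2 < (sqrt D)\<^sup>2" by (intro power_strict_mono) auto
  then have q: "(12 * s - 13 * \<beta>)\<^sup>2 < 13 * \<beta>\<^sup>2 - 12 * \<beta> * L - 72 * L\<^sup>2" using D0 by (simp add: D_def)
  have "24 * \<beta> * ((\<beta> + L) / 2 - s + 6 / \<beta> * (\<beta> - s)\<^sup>2 + 3 * L\<^sup>2 / \<beta>) =
      (12 * s - 13 * \<beta>)\<^sup>2 - (13 * \<beta>\<^sup>2 - 12 * \<beta> * L - 72 * L\<^sup>2)"
    using b0 by (simp add: field_simps power2_eq_square)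
  then have "24 * \<beta> * ((\<beta> + L) / 2 - s + 6 / \<beta> * (\<beta> - s)\<^sup>2 + 3 * L\<^sup>2 / \<beta>) < 0" using q by simp
  then show ?thesis using b0 by (simp add: mult_less_0_iff s_def)
qed

theorem theorem3p7:
  fixes P :: "('c::finite, 'm::finite) problem"
    and L \<beta> \<gamma> \<epsilon> \<kappa>1 \<kappa>2 \<kappa>3 \<tau> :: real
    and H :: "nat \<Rightarrow> real^'c^'c"
    and x :: "nat \<Rightarrow> real^'c" and y lam :: "nat \<Rightarrow> real^'m"
    and N K kstar :: nat
  assumes N: "N = nblocks P"
    and standing: "standing_assumptions P L"
    and algorithm: "generated_by_algorithm P \<beta> \<gamma> H x y lam"
    and beta: "\<beta> > (6 + 18 * sqrt 3) / 13 * L"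
    and gamma: "\<gamma> \<in> {12 / (13 * \<beta> + sqrt (13 * \<beta>\<^sup>2 - 12 * \<beta> * L - 72 * L\<^sup>2)) <..<
                     12 / (13 * \<beta> - sqrt (13 * \<beta>\<^sup>2 - 12 * \<beta> * L - 72 * L\<^sup>2))}"
    and H: "\<And>i. i \<in> {1..N - 1} \<Longrightarrow>
              pos_def_on (block_space P i) (H i - mat (6 * L\<^sup>2 / \<beta>))"
    and kappa1: "\<kappa>1 = 3 / \<beta>\<^sup>2 * ((\<beta> - 1 / \<gamma>)\<^sup>2 + L\<^sup>2)"
    and kappa2: "\<kappa>2 = (\<bar>\<beta> - 1 / \<gamma>\<bar> + L)\<^sup>2"
    and kappa3: "\<kappa>3 =
        (L + \<beta> * sqrt (real N) *
               max (MAX i\<in>{1..N - 1}. (mat_norm2 (cmat P i))\<^sup>2) ((mat_norm2 (mat 1 :: real^'m^'m))\<^sup>2)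
           + (MAX i\<in>{1..N - 1}. mat_norm2 (H i)))\<^sup>2"
    and tau: "\<tau> =
        min (- ((\<beta> + L) / 2 - 1 / \<gamma> + 6 / \<beta> * (\<beta> - 1 / \<gamma>)\<^sup>2 + 3 * L\<^sup>2 / \<beta>))
            (MIN i\<in>{1..N - 1}. - (3 * L\<^sup>2 / \<beta> - sigma_min_on (block_space P i) (H i) / 2))"
    and eps: "\<epsilon> > 0"
    and K: "K = nat \<lceil>2 * max \<kappa>1 (max \<kappa>2 \<kappa>3) / (\<tau> * \<epsilon>\<^sup>2) *
                  (potential P L \<beta> \<gamma> (x 1) (y 1) (lam 1) (y 0)
                     - (\<Sum>i=1..N - 1. reg_opt P i) - obj_opt P)\<rceil>"
    and kstar: "is_arg_min
        (\<lambda>k. (\<Sum>i=1..N - 1. (norm (block P i (x k) - block P i (x (k + 1))))\<^sup>2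
                             + (norm (block P i (x (k - 1)) - block P i (x k)))\<^sup>2)
             + ((norm (y k - y (k + 1)))\<^sup>2 + (norm (y (k - 1) - y k))\<^sup>2))
        (\<lambda>k. k \<in> {2..K + 1}) kstar"
  shows "eps_stationary P \<epsilon> (x (kstar + 1)) (y (kstar + 1)) (lam (kstar + 1))"
proof -
  interpret algorithm_run P L \<beta> \<gamma> H x y lam
    by (unfold_locales) (rule standing, rule algorithm)
  have tau_gain: "\<tau> = step_gain" by (simp add: tau step_gain_def N)
  have fin: "finite {1..N - 1}" "{1..N - 1} \<noteq> {}" using nblocks N by auto
  have sigma: "6 * L\<^sup>2 / \<beta> < sigma_min_on (block_space P i) (H i)" if "i \<in> {1..N - 1}" for i
  proof -
    have i: "i \<in> blocks" using that N by simp
    then obtain c where c: "block_of P c = i" using range_block_of by (metis image_iff)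
    \<comment> \<open>Every block owns a coordinate, so its space contains a nonzero vector and has
      singular values.\<close>
    have "axis c 1 \<in> block_space P i" "axis c 1 \<noteq> (0 :: real^'c)"
      using c by (auto simp: block_space_def coord_space_def axis_def vec_eq_iff)
    then show ?thesis
      using less_sigma_min_on H_block[OF i] H[OF that] subspace_coord_space block_space_def by metis
  qed
  have tau0: "\<tau> > 0"
    unfolding tau min_less_iff_conj
  proof (intro conjI)
    show "0 < - ((\<beta> + L) / 2 - 1 / \<gamma> + 6 / \<beta> * (\<beta> - 1 / \<gamma>)\<^sup>2 + 3 * L\<^sup>2 / \<beta>)"
      using step_size_quadratic_neg[OF L_pos beta gamma] by simp
    show "0 < (MIN i\<in>{1..N - 1}. - (3 * L\<^sup>2 / \<beta> - sigma_min_on (block_space P i) (H i) / 2))"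
      using fin sigma by (subst Min_gr_iff) (auto simp: field_simps)
  qed
  define \<kappa> where "\<kappa> = max \<kappa>1 (max \<kappa>2 \<kappa>3)"
  define gap where "gap = Psi 0 - (\<Sum>i\<in>blocks. reg_opt P i) - obj_opt P"
  define \<theta> where "\<theta> k = dx k + dy k + (dx (k - 1) + dy (k - 1))" for k
  have theta: "(\<Sum>i=1..N - 1. (norm (block P i (x k) - block P i (x (k + 1))))\<^sup>2
                             + (norm (block P i (x (k - 1)) - block P i (x k)))\<^sup>2)
             + ((norm (y k - y (k + 1)))\<^sup>2 + (norm (y (k - 1) - y k))\<^sup>2) = \<theta> k"
    if "k \<in> {2..K + 1}" for k
  proof -
    have "Suc (k - 1) = k" using that by simp
    then show ?thesis
      using dx_blocks[of k] dx_blocks[of "k - 1"]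
      by (simp add: N \<theta>_def sum.distrib dy_def)
  qed
  have ks: "kstar \<in> {2..K + 1}" and ks_min: "\<And>k. k \<in> {2..K + 1} \<Longrightarrow> \<theta> kstar \<le> \<theta> k"
    using kstar theta unfolding is_arg_min_def by (auto simp: not_less)
  obtain k where k: "kstar = Suc k" "k \<ge> 1" using ks by (cases kstar) auto
  \<comment> \<open>The index range is empty for \<open>K = 0\<close>, so the mere existence of
    \<open>kstar\<close> forces \<open>K\<close> to be positive.\<close>
  have K0: "real K > 0" using ks by simp
  have k1: "\<kappa> \<ge> 0" by (simp add: \<kappa>_def kappa2 le_max_iff_disj)
  have theta0: "0 \<le> \<theta> kstar" using dx_nonneg dy_nonneg by (simp add: \<theta>_def)
  let ?d = "\<lambda>k. dx (Suc k) + dy (Suc k)"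
  have "real K * \<theta> kstar = (\<Sum>k<K. \<theta> kstar)" by simp
  \<comment> \<open>The minimum is at most the average over the \<open>K\<close> indices from 2 to
    \<open>K + 1\<close>.\<close>
  also have "\<dots> \<le> (\<Sum>k<K. \<theta> (k + 2))" by (intro sum_mono ks_min) auto
  also have "\<dots> = (\<Sum>k<K. ?d (Suc k)) + (\<Sum>k<K. ?d k)"
    by (simp add: \<theta>_def sum.distrib numeral_2_eq_2)
  \<comment> \<open>Neighbouring pairs share a step, so each step is counted at most twice; this is
    the factor 2 in \<open>K\<close>.\<close>
  also have "\<dots> \<le> 2 * (\<Sum>k<Suc K. ?d k)"
  proof -
    have "(\<Sum>k<Suc K. ?d k) = ?d 0 + (\<Sum>k<K. ?d (Suc k))" by (rule sum.lessThan_Suc_shift)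
    moreover have "(\<Sum>k<Suc K. ?d k) = (\<Sum>k<K. ?d k) + ?d K" by (rule sum.lessThan_Suc)
    moreover have "0 \<le> ?d j" for j using dx_nonneg dy_nonneg by (simp add: add_nonneg_nonneg)
    ultimately show ?thesis using \<open>0 \<le> ?d 0\<close> \<open>0 \<le> ?d K\<close> by linarith
  qed
  finally have "\<tau> * (real K * \<theta> kstar) \<le> \<tau> * (2 * (\<Sum>k<Suc K. ?d k))"
    using tau0 by (intro mult_left_mono) auto
  also have "\<dots> = 2 * (\<tau> * (\<Sum>k<Suc K. ?d k))" by (rule mult.left_commute)
  also have "\<dots> \<le> 2 * gap"
    unfolding tau_gain gap_def
    by (intro mult_left_mono sum_steps_le) (use tau0 tau_gain in simp_all)
  finally have sum: "\<tau> * (real K * \<theta> kstar) \<le> 2 * gap" .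
  \<comment> \<open>Rounding up and truncating at 0 can only increase the value, so no sign of the
    gap is required.\<close>
  have "2 * \<kappa> / (\<tau> * \<epsilon>\<^sup>2) * gap \<le> real K"
    unfolding K by (simp add: \<kappa>_def gap_def Psi_def N of_nat_ceiling)
  then have "2 * \<kappa> * gap \<le> real K * (\<tau> * \<epsilon>\<^sup>2)"
    using tau0 eps by (simp add: divide_le_eq)
  moreover have "\<kappa> * (\<tau> * (real K * \<theta> kstar)) \<le> \<kappa> * (2 * gap)"
    using sum k1 by (rule mult_left_mono)
  ultimately have "(real K * \<tau>) * (\<kappa> * \<theta> kstar) \<le> (real K * \<tau>) * \<epsilon>\<^sup>2"
    by (simp add: algebra_simps)
  then have small: "\<kappa> * \<theta> kstar \<le> \<epsilon>\<^sup>2"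
    using K0 tau0 by (simp add: mult_le_cancel_left)
  have "c * \<theta> kstar \<le> \<epsilon>\<^sup>2" if "c \<le> \<kappa>" for c
    using small mult_right_mono[OF that theta0] by linarith
  then have small': "\<kappa>1 * \<theta> kstar \<le> \<epsilon>\<^sup>2" "\<kappa>2 * \<theta> kstar \<le> \<epsilon>\<^sup>2" "\<kappa>3 * \<theta> kstar \<le> \<epsilon>\<^sup>2"
    by (simp_all add: \<kappa>_def)
  have th: "\<theta> kstar = dx (Suc k) + dy (Suc k) + (dx k + dy k)" by (simp add: \<theta>_def k)
  have "eps_stationary P \<epsilon> (x (Suc (Suc k))) (y (Suc (Suc k))) (lam (Suc (Suc k)))"
  proof (rule eps_stationary_of_small_steps)
    let ?a = "max (MAX i\<in>{1..N - 1}. (mat_norm2 (cmat P i))\<^sup>2) ((mat_norm2 (mat 1 :: real^'m^'m))\<^sup>2)"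
    let ?h = "MAX i\<in>{1..N - 1}. mat_norm2 (H i)"
    show "(mat_norm2 (cmat P j))\<^sup>2 \<le> ?a" if "j \<in> blocks" for j
      using that fin N by (intro max.coboundedI1 Max_ge) auto
    show "(mat_norm2 (mat 1 :: real^'m^'m))\<^sup>2 \<le> ?a" by simp
    show "mat_norm2 (H i) \<le> ?h" if "i \<in> blocks" for i
      using that fin N by (intro Max_ge) auto
    show "0 < \<epsilon>" by (rule eps)
    show "3 / \<beta>\<^sup>2 * ((\<beta> - 1 / \<gamma>)\<^sup>2 + L\<^sup>2) * (dx (Suc k) + dy (Suc k) + (dx k + dy k)) \<le> \<epsilon>\<^sup>2"
      using small'(1) unfolding th kappa1 .
    show "(\<bar>\<beta> - 1 / \<gamma>\<bar> + L)\<^sup>2 * (dx (Suc k) + dy (Suc k) + (dx k + dy k)) \<le> \<epsilon>\<^sup>2"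
      using small'(2) unfolding th kappa2 .
    show "(L + \<beta> * sqrt (nblocks P) * ?a + ?h)\<^sup>2 * (dx (Suc k) + dy (Suc k) + (dx k + dy k)) \<le> \<epsilon>\<^sup>2"
      using small'(3) unfolding th kappa3 N .
  qed
  then show ?thesis by (simp add: k)
qed

end
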